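(* Let $\alpha>0$ and let $\mathbb D$ be the open unit disk in $\mathbb C$, $r\mathbb D=\{rz: z\in\mathbb D\}$. Then $$\lim_{r\to\infty}\frac1{r^{2\alpha}}\log\mathbf P\big[\mathcal X_\infty^{(\alpha)}(r\mathbb D)=0\big]=-\frac\alpha2\cdot\frac14.$$
   Context: For $\alpha>0$, $\mathcal X_\infty^{(\alpha)}$ is the determinantal point process in $\mathbb C$ with kernel $\mathbb K_\infty^{(\alpha)}(z,w)=\frac{\alpha}{2\pi}E_{\frac2\alpha,\frac2\alpha}(z\bar w)e^{-\frac{|z|^\alpha}{2}-\frac{|w|^\alpha}{2}}$ with respect to Lebesgue measure $m$ on $\mathbb C$, where $E_{a,b}(z)=\sum_{k=0}^\infty \frac{z^k}{\Gamma(ak+b)}$ is the Mittag-Leffler function. That is, it is a simple point process whose joint intensities (correlation functions) with respect to $m$ are $\rho_k(x_1,\dots,x_k)=\det(\mathbb K_\infty^{(\alpha)}(x_i,x_j))_{1\le i,j\le k}$ for every $k\ge 1$. $\mathcal X_\infty^{(\alpha)}(\Omega)$ denotes the number of points falling in $\Omega\subset\mathbb C$. *)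

theory Defs
  imports "HOL-Probability.Probability" "Jordan_Normal_Form.Determinant"
begin

(* Takes the value \<infinity> when the configuration S has infinitely many points in D. *)
definition num_points :: "'a set \<Rightarrow> 'a set \<Rightarrow> ennreal" where
  "num_points S D = emeasure (count_space UNIV) (S \<inter> D)"

(* A simple point process (no multiple points) is a random locally finite subset of the
   state space; the random counting measure is D \<mapsto> num_points (X \<omega>) D. *)
definition simple_point_process :: "'w measure \<Rightarrow> ('w \<Rightarrow> 'a::topological_space set) \<Rightarrow> bool" where
  "simple_point_process M X \<longleftrightarrow>
     prob_space M \<and>
     (\<forall>\<omega>\<in>space M. \<forall>C. compact C \<longrightarrow> finite (X \<omega> \<inter> C)) \<and>
     (\<forall>B\<in>sets borel. (\<lambda>\<omega>. num_points (X \<omega>) B) \<in> borel_measurable M)"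

(* rho k is the k-th joint intensity (correlation function) with respect to mu; a k-tuple of
   points is an extensional function on {..<k}.  The defining identity is required for
   pairwise disjoint Borel sets, and rho k vanishes on tuples with a repeated point, as in
   Hough, Krishnapur, Peres and Virag, "Zeros of Gaussian Analytic Functions and
   Determinantal Point Processes". *)
definition joint_intensities ::
  "'w measure \<Rightarrow> ('w \<Rightarrow> 'a::topological_space set) \<Rightarrow> 'a measure \<Rightarrow>
     (nat \<Rightarrow> (nat \<Rightarrow> 'a) \<Rightarrow> real) \<Rightarrow> bool" where
  "joint_intensities M X \<mu> \<rho> \<longleftrightarrow>
     (\<forall>k\<ge>1.
        \<rho> k \<in> borel_measurable (Pi\<^sub>M {..<k} (\<lambda>_. \<mu>)) \<and>
        (\<forall>x\<in>space (Pi\<^sub>M {..<k} (\<lambda>_. \<mu>)).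
           0 \<le> \<rho> k x \<and> (\<not> inj_on x {..<k} \<longrightarrow> \<rho> k x = 0)) \<and>
        (\<forall>D. (\<forall>i<k. D i \<in> sets borel) \<and> disjoint_family_on D {..<k} \<longrightarrow>
           (\<integral>\<^sup>+\<omega>. (\<Prod>i<k. num_points (X \<omega>) (D i)) \<partial>M) =
           (\<integral>\<^sup>+x\<in>Pi\<^sub>E {..<k} D. ennreal (\<rho> k x) \<partial>Pi\<^sub>M {..<k} (\<lambda>_. \<mu>))))"

definition determinantal_point_process ::
  "'w measure \<Rightarrow> ('w \<Rightarrow> 'a::topological_space set) \<Rightarrow> 'a measure \<Rightarrow>
     ('a \<Rightarrow> 'a \<Rightarrow> complex) \<Rightarrow> bool" where
  "determinantal_point_process M X \<mu> K \<longleftrightarrow>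
     simple_point_process M X \<and>
     (\<exists>\<rho>. joint_intensities M X \<mu> \<rho> \<and>
        (\<forall>k\<ge>1. \<forall>x\<in>space (Pi\<^sub>M {..<k} (\<lambda>_. \<mu>)).
           complex_of_real (\<rho> k x) =
             Determinant.det (Matrix.mat k k (\<lambda>(i, j). K (x i) (x j)))))"

definition mittag_leffler :: "real \<Rightarrow> real \<Rightarrow> complex \<Rightarrow> complex" where
  "mittag_leffler a b z = (\<Sum>k. z ^ k / complex_of_real (Gamma (a * real k + b)))"

definition mittag_leffler_kernel :: "real \<Rightarrow> complex \<Rightarrow> complex \<Rightarrow> complex" where
  "mittag_leffler_kernel \<alpha> z w =
     complex_of_real (\<alpha> / (2 * pi)) * mittag_leffler (2 / \<alpha>) (2 / \<alpha>) (z * cnj w) *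
     complex_of_real (exp (- (cmod z powr \<alpha>) / 2 - (cmod w powr \<alpha>) / 2))"

end

theory Submission
  imports Defs "HOL-Combinatorics.Multiset_Permutations" "HOL-Real_Asymp.Real_Asymp"
begin

text \<open>
  Write \<open>N\<close> for the number of points in the disk of radius \<open>r\<close>, \<open>R = r powr \<alpha>\<close> and
  \<open>\<beta> = 2 / \<alpha>\<close>. The hole probability has an exact product formula,
  \<open>P[N = 0] = (\<Prod>j\<ge>1. Q (\<beta> j) R)\<close>, where \<open>Q a R\<close> is the probability that a gamma
  variable of shape \<open>a\<close> and rate 1 is at least \<open>R\<close>; the limit is read off from it.

  For the product formula, partition the disk into finitely many cells and refine the partition.
  The joint intensities on tuples with entries in distinct cells increase to the factorial moments
  of \<open>N\<close> (\<open>factorial_moment\<close>), and inclusion-exclusion gives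
  \<open>P[N = 0] = (\<Sum>k. (-1)\<^sup>k / k! * \<integral> \<rho>\<^sub>k)\<close> with the integral over \<open>k\<close>-tuples in the disk
  (\<open>void_probability_sums\<close>). The monomials, suitably weighted, are orthogonal on the
  disk because Lebesgue measure is rotation invariant (\<open>lborel_distr_rotation\<close>,
  \<open>integral_monomials_orthogonal\<close>), and they expand the Mittag-Leffler kernel. For an
  orthogonal expansion with squared norms \<open>l\<^sub>j\<close>, the integral of the \<open>k\<close>-th determinant is
  \<open>k!\<close> times the \<open>k\<close>-th elementary symmetric function of the \<open>l\<^sub>j\<close>
  (\<open>integral_det_finite_rank\<close>), so that the alternating series sums to
  \<open>\<Prod>j. 1 - l\<^sub>j\<close> (\<open>void_probability_product\<close>). In polar coordinates \<open>1 - l\<^sub>j\<close> is a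
  gamma tail (\<open>ml_basis_norm_integral\<close>).

  For the asymptotics, Chernoff's bound and a matching lower bound give
  \<open>- ln (Q a R) = R h(a / R) + O(ln R)\<close> for \<open>a \<le> R\<close>, with \<open>h(x) = 1 - x + x ln x\<close>,
  uniformly for \<open>a\<close> bounded below. The
  factors with \<open>R \<le> a \<le> 9 R\<close> contribute \<open>O(R ln R)\<close> to the logarithm, and those with
  \<open>a \<ge> 9 R\<close> have a product bounded away from 0. Hence
  \<open>- ln P[N = 0]\<close> is, to leading order, the Riemann sum of
  \<open>R h(\<beta> j / R)\<close> over \<open>j \<le> R / \<beta>\<close>, which is asymptotic to \<open>R\<^sup>2 / \<beta>\<close> times
  the integral of \<open>h\<close> over the unit interval, that is to \<open>R\<^sup>2 / (4 \<beta>)\<close>.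
\<close>

section \<open>Injective tuples and elementary symmetric functions\<close>

text \<open>
  Injective \<open>k\<close>-tuples of elements of \<open>A\<close>; a tuple is an extensional function on
  \<open>{..<k}\<close>, as in the product measures \<open>Pi\<^sub>M {..<k} _\<close>.
\<close>

definition inj_tuples :: "nat \<Rightarrow> 'a set \<Rightarrow> (nat \<Rightarrow> 'a) set" where
  "inj_tuples k A = {f \<in> {..<k} \<rightarrow>\<^sub>E A. inj_on f {..<k}}"

lemma finite_inj_tuples [simp, intro]: "finite A \<Longrightarrow> finite (inj_tuples k A)"
  by (simp add: inj_tuples_def finite_PiE)

text \<open>
  The injective \<open>k\<close>-tuples with a given range are the orderings of that range.
\<close>

lemma card_inj_tuples_image:
  assumes "finite S" "card S = k"
  shows "card {f \<in> inj_tuples k A. f ` {..<k} = S} = (if S \<subseteq> A then fact k else 0)"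
proof (cases "S \<subseteq> A")
  case True
  let ?F = "{f \<in> inj_tuples k A. f ` {..<k} = S}"
  let ?h = "\<lambda>f. map f [0..<k]"
  have "inj_on ?h ?F"
  proof (rule inj_onI)
    fix f g assume f: "f \<in> ?F" and g: "g \<in> ?F" and eq: "?h f = ?h g"
    show "f = g"
    proof (rule PiE_ext[of f "{..<k}" "\<lambda>_. A" g])
      fix x assume "x \<in> {..<k}"
      then show "f x = g x" using eq by (simp add: list_eq_iff_nth_eq)
    qed (use f g in \<open>auto simp: inj_tuples_def\<close>)
  qed
  moreover have "?h ` ?F = permutations_of_set S"
  proof (intro equalityI subsetI)
    fix xs assume "xs \<in> ?h ` ?F"
    then obtain f where f: "f \<in> ?F" "xs = ?h f" by blast
    then show "xs \<in> permutations_of_set S"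
      by (auto simp: permutations_of_set_def distinct_map inj_tuples_def lessThan_atLeast0)
  next
    fix xs assume "xs \<in> permutations_of_set S"
    then have xs: "set xs = S" "distinct xs" by (auto simp: permutations_of_set_def)
    then have len: "length xs = k" using assms distinct_card by metis
    let ?f = "restrict ((!) xs) {..<k}"
    have im: "?f ` {..<k} = S" using xs len by (auto simp: set_conv_nth)
    have "inj_on ?f {..<k}"
      using xs len by (auto simp: inj_on_def nth_eq_iff_index_eq)
    then have "?f \<in> ?F" using im True by (auto simp: inj_tuples_def)
    moreover have "xs = ?h ?f" using len by (auto intro!: nth_equalityI)
    ultimately show "xs \<in> ?h ` ?F" by blast
  qed
  ultimately have "card ?F = card (permutations_of_set S)"
    using card_image[of ?h ?F] by simp
  then show ?thesis using True assms by (simp add: card_permutations_of_set)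
next
  case False
  have "f ` {..<k} \<subseteq> A" if "f \<in> inj_tuples k A" for f
    using that by (auto simp: inj_tuples_def)
  with False have "{f \<in> inj_tuples k A. f ` {..<k} = S} = {}" by blast
  then have "card {f \<in> inj_tuples k A. f ` {..<k} = S} = 0" by (simp only: card.empty)
  then show ?thesis using False by simp
qed

lemma sum_inj_tuples:
  fixes g :: "'a \<Rightarrow> 'b::comm_semiring_1"
  assumes A: "finite A"
  shows "(\<Sum>f\<in>inj_tuples k A. \<Prod>i<k. g (f i)) =
    of_nat (fact k) * (\<Sum>S | S \<subseteq> A \<and> card S = k. \<Prod>x\<in>S. g x)"
proof -
  let ?P = "{S. S \<subseteq> A \<and> card S = k}"
  have fin: "finite ?P" using A by simp
  have im: "(\<lambda>f. f ` {..<k}) ` inj_tuples k A \<subseteq> ?P"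
    by (force simp: inj_tuples_def card_image)
  have "(\<Sum>f\<in>inj_tuples k A. \<Prod>i<k. g (f i)) =
      (\<Sum>S\<in>?P. \<Sum>f | f \<in> inj_tuples k A \<and> f ` {..<k} = S. \<Prod>i<k. g (f i))"
    by (rule sum.group[symmetric]) (use A fin im in auto)
  also have "\<dots> = (\<Sum>S\<in>?P. \<Sum>f | f \<in> inj_tuples k A \<and> f ` {..<k} = S. \<Prod>x\<in>S. g x)"
  proof (intro sum.cong refl)
    fix S f assume "f \<in> {f \<in> inj_tuples k A. f ` {..<k} = S}"
    then show "(\<Prod>i<k. g (f i)) = (\<Prod>x\<in>S. g x)"
      using prod.reindex[of f "{..<k}" g] by (auto simp: inj_tuples_def)
  qed
  also have "\<dots> = (\<Sum>S\<in>?P. of_nat (fact k) * (\<Prod>x\<in>S. g x))"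
  proof (intro sum.cong refl)
    fix S assume "S \<in> ?P"
    then show "(\<Sum>f | f \<in> inj_tuples k A \<and> f ` {..<k} = S. \<Prod>x\<in>S. g x) = of_nat (fact k) * (\<Prod>x\<in>S. g x)"
      using card_inj_tuples_image[of S k A] A by (auto dest: finite_subset)
  qed
  also have "\<dots> = of_nat (fact k) * (\<Sum>S\<in>?P. \<Prod>x\<in>S. g x)" by (simp add: sum_distrib_left)
  finally show ?thesis .
qed

lemma card_inj_tuples:
  assumes "finite A"
  shows "card (inj_tuples k A) = fact k * (card A choose k)"
  using sum_inj_tuples[OF assms, where g = "\<lambda>_. 1::nat" and k = k] n_subsets[OF assms, of k] by simp

lemma prod_one_minus_eq_sum_inj_tuples:
  fixes g :: "'a \<Rightarrow> real"
  assumes A: "finite A"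
  shows "(\<Prod>x\<in>A. 1 - g x) = (\<Sum>k\<le>card A. (-1) ^ k / fact k * (\<Sum>f\<in>inj_tuples k A. \<Prod>i<k. g (f i)))"
proof -
  have "(\<Prod>x\<in>A. 1 - g x) = (\<Sum>S\<in>Pow A. (-1) ^ card S * (\<Prod>x\<in>S. g x))"
    by (subst prod_diff_conv_sum[OF A]) simp
  also have "\<dots> = (\<Sum>k\<le>card A. \<Sum>S | S \<in> Pow A \<and> card S = k. (-1) ^ card S * (\<Prod>x\<in>S. g x))"
    by (rule sum.group[symmetric]) (use A in \<open>auto intro: card_mono\<close>)
  also have "\<dots> = (\<Sum>k\<le>card A. (-1) ^ k * (\<Sum>S | S \<subseteq> A \<and> card S = k. \<Prod>x\<in>S. g x))"
    unfolding sum_distrib_left by (intro sum.cong refl) auto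
  also have "\<dots> = (\<Sum>k\<le>card A. (-1) ^ k / fact k * (\<Sum>f\<in>inj_tuples k A. \<Prod>i<k. g (f i)))"
    unfolding sum_inj_tuples[OF A] by (simp add: field_simps)
  finally show ?thesis .
qed

lemma inj_tuples_eq_empty:
  assumes "finite A" "card A < k"
  shows "inj_tuples k A = {}"
  using card_inj_tuples[OF assms(1), of k] assms finite_inj_tuples[OF assms(1), of k]
  by (simp add: binomial_eq_0)

section \<open>Factorial moments from joint intensities\<close>

lemma num_points_finite:
  assumes "finite (S \<inter> D)"
  shows "num_points S D = of_nat (card (S \<inter> D))"
  using assms by (simp add: num_points_def)

text \<open>
  The sets \<open>U 0, ..., U (m - 1)\<close> partition the space into at most \<open>2 ^ m\<close> cells; a cell is
  named by the set of indices \<open>i < m\<close> with \<open>U i\<close> containing it. The partition becomes finer as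
  \<open>m\<close> grows.
\<close>

definition cell_code :: "(nat \<Rightarrow> 'a set) \<Rightarrow> nat \<Rightarrow> 'a \<Rightarrow> nat set" where
  "cell_code U m z = {i. i < m \<and> z \<in> U i}"

text \<open>
  Tuples of elements of \<open>B\<close> whose entries lie in pairwise distinct cells.
\<close>

definition separated_tuples ::
  "(nat \<Rightarrow> 'a set) \<Rightarrow> nat \<Rightarrow> nat \<Rightarrow> 'a set \<Rightarrow> (nat \<Rightarrow> 'a) set" where
  "separated_tuples U m k B = {x \<in> {..<k} \<rightarrow>\<^sub>E B. inj_on (\<lambda>i. cell_code U m (x i)) {..<k}}"

lemma ex_separating_sequence:
  "\<exists>U :: nat \<Rightarrow> 'a::{second_countable_topology, t2_space} set.
     (\<forall>i. open (U i)) \<and> (\<forall>x y. x \<noteq> y \<longrightarrow> (\<exists>i. x \<in> U i \<and> y \<notin> U i))"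
proof -
  obtain \<B> :: "'a set set" where \<B>: "countable \<B>" "topological_basis \<B>"
    using ex_countable_basis by blast
  have sep: "\<exists>V\<in>\<B>. x \<in> V \<and> y \<notin> V" if "x \<noteq> y" for x y
  proof -
    obtain W where "open W" "x \<in> W" "y \<notin> W" using \<open>x \<noteq> y\<close> t1_space by blast
    then obtain V where "V \<in> \<B>" "x \<in> V" "V \<subseteq> W" using \<B>(2) by (auto elim: topological_basisE)
    then show ?thesis using \<open>y \<notin> W\<close> by blast
  qed
  \<comment> \<open>UNIV is added because \<open>from_nat_into\<close> enumerates only nonempty sets.\<close>
  let ?U = "from_nat_into (insert UNIV \<B>)"
  have r: "range ?U = insert UNIV \<B>" using \<B>(1) by (intro range_from_nat_into) auto
  have "open (?U i)" for i
  proof -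
    have "?U i \<in> insert UNIV \<B>" using r by blast
    then show ?thesis using topological_basis_open[OF \<B>(2)] by auto
  qed
  moreover have "\<exists>i. x \<in> ?U i \<and> y \<notin> ?U i" if "x \<noteq> y" for x y
  proof -
    obtain V where V: "V \<in> \<B>" "x \<in> V" "y \<notin> V" using sep[OF \<open>x \<noteq> y\<close>] by blast
    then have "V \<in> range ?U" using r by simp
    then obtain i where "V = ?U i" by (rule rangeE)
    then show ?thesis using V by auto
  qed
  ultimately show ?thesis by blast
qed

lemma cell_code_mono:
  assumes "m \<le> n" "cell_code U n x = cell_code U n y"
  shows "cell_code U m x = cell_code U m y"
proof -
  have "cell_code U m z = cell_code U n z \<inter> {..<m}" for z
    using assms(1) by (auto simp: cell_code_def)
  then show ?thesis using assms(2) by simp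
qed

lemma eventually_inj_on_cell_code:
  assumes "\<And>x y. x \<noteq> y \<Longrightarrow> \<exists>i. x \<in> U i \<and> y \<notin> U i" and "finite F"
  shows "\<forall>\<^sub>F m in sequentially. inj_on (cell_code U m) F"
proof -
  have "\<forall>\<^sub>F m in sequentially. cell_code U m x \<noteq> cell_code U m y" if "x \<noteq> y" for x y
  proof -
    obtain i where i: "x \<in> U i" "y \<notin> U i" using assms(1)[OF \<open>x \<noteq> y\<close>] by blast
    show ?thesis using eventually_gt_at_top[of i]
    proof eventually_elim
      case (elim m)
      then have "i \<in> cell_code U m x" "i \<notin> cell_code U m y" using i by (auto simp: cell_code_def)
      then show ?case by blast
    qed
  qed
  then have "\<forall>\<^sub>F m in sequentially. \<forall>x\<in>F. \<forall>y\<in>F. x \<noteq> y \<longrightarrow> cell_code U m x \<noteq> cell_code U m y"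
    using assms(2) by (auto intro!: eventually_ball_finite)
  then show ?thesis by (rule eventually_mono) (auto simp: inj_on_def)
qed

lemma separated_tuples_mono:
  assumes "m \<le> n"
  shows "separated_tuples U m k B \<subseteq> separated_tuples U n k B"
proof
  fix x assume x: "x \<in> separated_tuples U m k B"
  have "inj_on (\<lambda>i. cell_code U n (x i)) {..<k}"
  proof (rule inj_onI)
    fix i j assume ij: "i \<in> {..<k}" "j \<in> {..<k}" and "cell_code U n (x i) = cell_code U n (x j)"
    then have "cell_code U m (x i) = cell_code U m (x j)" using cell_code_mono[OF assms] by metis
    then show "i = j" using x ij by (auto simp: separated_tuples_def dest: inj_onD)
  qed
  then show "x \<in> separated_tuples U n k B" using x by (simp add: separated_tuples_def)
qed

lemma eventually_separated_tuples:
  assumes "\<And>x y. x \<noteq> y \<Longrightarrow> \<exists>i. x \<in> U i \<and> y \<notin> U i" and "finite F"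
  shows "\<forall>\<^sub>F m in sequentially. separated_tuples U m k F = inj_tuples k F"
proof -
  have "\<forall>\<^sub>F m in sequentially. inj_on (cell_code U m) F"
    using assms by (rule eventually_inj_on_cell_code)
  then show ?thesis
  proof eventually_elim
    case (elim m)
    have "inj_on (\<lambda>i. cell_code U m (x i)) {..<k} \<longleftrightarrow> inj_on x {..<k}" if "x \<in> {..<k} \<rightarrow>\<^sub>E F" for x
      using elim that by (auto simp: inj_on_def PiE_iff)
    then show ?case by (auto simp: separated_tuples_def inj_tuples_def)
  qed
qed

text \<open>
  The separated tuples are the disjoint union, over all injective choices \<open>e\<close> of cells, of the
  boxes \<open>D (e 0) \<times> ... \<times> D (e (k - 1))\<close>, where \<open>D v\<close> is the part of \<open>B\<close> in the cell named
  \<open>v\<close>. The factors of each box are disjoint, which is what the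
  definition of joint intensities requires.
\<close>

lemma indicator_separated_tuples:
  assumes "x \<in> extensional {..<k}"
  shows "indicator (separated_tuples U m k B) x =
    (\<Sum>e\<in>inj_tuples k (Pow {..<m}).
       indicator (PiE {..<k} (\<lambda>i. {z \<in> B. cell_code U m z = e i})) x :: 'b::semiring_1)"
  (is "_ = (\<Sum>e\<in>?E. indicator (?D e) x)")
proof -
  define e0 where "e0 = restrict (\<lambda>i. cell_code U m (x i)) {..<k}"
  have eq: "x \<in> ?D e \<longleftrightarrow> e = e0 \<and> x \<in> {..<k} \<rightarrow>\<^sub>E B" if "e \<in> ?E" for e
  proof -
    have ext: "e \<in> extensional {..<k}" using that by (auto simp: inj_tuples_def PiE_iff)
    have "e = e0 \<longleftrightarrow> (\<forall>i<k. e i = cell_code U m (x i))"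
    proof
      assume "\<forall>i<k. e i = cell_code U m (x i)"
      then show "e = e0" using ext by (intro extensionalityI[of e "{..<k}"]) (simp_all add: e0_def)
    next
      assume e: "e = e0"
      show "\<forall>i<k. e i = cell_code U m (x i)" by (simp add: e e0_def)
    qed
    then show ?thesis using assms by (auto simp: PiE_iff)
  qed
  have "e0 \<in> {..<k} \<rightarrow>\<^sub>E Pow {..<m}" by (auto simp: cell_code_def e0_def)
  then have mem: "e0 \<in> ?E \<longleftrightarrow> inj_on (\<lambda>i. cell_code U m (x i)) {..<k}"
    by (simp add: inj_tuples_def inj_on_def e0_def)
  have "(\<Sum>e\<in>?E. indicator (?D e) x :: 'b) =
      (\<Sum>e\<in>?E. if e = e0 then of_bool (x \<in> {..<k} \<rightarrow>\<^sub>E B) else 0)"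
    by (intro sum.cong refl) (simp add: eq indicator_def)
  also have "\<dots> = indicator (separated_tuples U m k B) x"
    using mem by (subst sum.delta) (auto simp: separated_tuples_def indicator_def)
  finally show ?thesis by simp
qed

lemma card_separated_tuples:
  assumes F: "finite F"
  shows "of_nat (card (separated_tuples U m k F)) =
    (\<Sum>e\<in>inj_tuples k (Pow {..<m}). \<Prod>i<k. of_nat (card {z \<in> F. cell_code U m z = e i}) :: 'b::comm_semiring_1)"
proof -
  let ?D = "\<lambda>e. PiE {..<k} (\<lambda>i. {z \<in> F. cell_code U m z = e i})"
  let ?A = "{..<k} \<rightarrow>\<^sub>E F"
  have fin: "finite ?A" using F by (simp add: finite_PiE)
  have sub: "separated_tuples U m k F \<subseteq> ?A" by (auto simp: separated_tuples_def)
  have subD: "?D e \<subseteq> ?A" for e by (auto simp: PiE_iff)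
  have card_ind: "of_nat (card T) = (\<Sum>x\<in>?A. indicator T x :: 'b)" if "T \<subseteq> ?A" for T
    using fin that by (simp add: sum.If_cases indicator_def Int_absorb1 of_bool_def)
  have "of_nat (card (separated_tuples U m k F)) =
      (\<Sum>x\<in>?A. \<Sum>e\<in>inj_tuples k (Pow {..<m}). indicator (?D e) x :: 'b)"
    unfolding card_ind[OF sub]
    by (intro sum.cong refl indicator_separated_tuples) (auto simp: PiE_iff)
  also have "\<dots> = (\<Sum>e\<in>inj_tuples k (Pow {..<m}). of_nat (card (?D e)))"
    by (subst sum.swap) (simp add: card_ind[OF subD])
  also have "\<dots> = (\<Sum>e\<in>inj_tuples k (Pow {..<m}). \<Prod>i<k. of_nat (card {z \<in> F. cell_code U m z = e i}))"
    by (simp add: card_PiE)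
  finally show ?thesis .
qed

text \<open>
  Let \<open>N\<close> be the number of points in \<open>B\<close>. The integral of the \<open>k\<close>-th joint intensity over
  \<open>B\<close>-valued tuples is the expected number of injective \<open>k\<close>-tuples of points in \<open>B\<close>, that is
  \<open>E[N (N - 1) ... (N - k + 1)]\<close>. For tuples separated by a partition this is the definition of joint
  intensities; both sides converge monotonically as the partition is refined. On the right the
  limit lacks the tuples with a repeated entry, where \<open>\<rho> k\<close> vanishes.
\<close>

theorem factorial_moment:
  fixes X :: "'w \<Rightarrow> 'a::{second_countable_topology, t2_space} set"
  assumes X: "simple_point_process M X" and \<rho>: "joint_intensities M X \<mu> \<rho>"
    and \<mu>: "sets \<mu> = sets borel" and B: "B \<in> sets borel"
    and fin: "\<And>\<omega>. \<omega> \<in> space M \<Longrightarrow> finite (X \<omega> \<inter> B)" and k: "k \<ge> 1"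
  shows "(\<integral>\<^sup>+\<omega>. of_nat (card (inj_tuples k (X \<omega> \<inter> B))) \<partial>M) =
    (\<integral>\<^sup>+x\<in>{..<k} \<rightarrow>\<^sub>E B. ennreal (\<rho> k x) \<partial>Pi\<^sub>M {..<k} (\<lambda>_. \<mu>))"
proof -
  obtain U :: "nat \<Rightarrow> 'a set" where U: "\<And>i. open (U i)"
    and sep: "\<And>x y. x \<noteq> y \<Longrightarrow> \<exists>i. x \<in> U i \<and> y \<notin> U i"
    using ex_separating_sequence by blast
  let ?P = "Pi\<^sub>M {..<k} (\<lambda>_. \<mu>)"
  let ?E = "\<lambda>m. inj_tuples k (Pow {..<m})"
  let ?T = "\<lambda>m. separated_tuples U m k B"
  define D where "D m v = {z \<in> B. cell_code U m z = v}" for m v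
  have space_\<mu>: "space \<mu> = UNIV" using sets_eq_imp_space_eq[OF \<mu>] by simp
  have D_sets: "D m v \<in> sets borel" for m v
  proof -
    define W where "W i = (if i \<in> v then U i else - U i)" for i
    have "W i \<in> sets borel" for i using U by (simp add: W_def)
    then have INT: "(\<Inter>i\<in>{..<m}. W i) \<in> sets borel"
      by (cases "m = 0") (auto intro!: sets.finite_INT simp: lessThan_empty_iff)
    have "{z \<in> B. cell_code U m z = v} = (if v \<subseteq> {..<m} then B \<inter> (\<Inter>i\<in>{..<m}. W i) else {})"
      by (auto simp: cell_code_def W_def split: if_splits)
    also have "\<dots> \<in> sets borel" using B INT by simp
    finally show ?thesis by (simp add: D_def)
  qed
  have \<rho>_meas [measurable]: "\<rho> k \<in> borel_measurable ?P" using \<rho> k by (simp add: joint_intensities_def)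
  have \<rho>_zero: "\<rho> k x = 0" if "x \<in> space ?P" "\<not> inj_on x {..<k}" for x
    using \<rho> k that by (simp add: joint_intensities_def)
  have N_meas [measurable]: "(\<lambda>\<omega>. num_points (X \<omega>) (D m v)) \<in> borel_measurable M" for m v
    using X D_sets by (simp add: simple_point_process_def)
  have PiE_D [measurable]: "PiE {..<k} (\<lambda>i. D m (e i)) \<in> sets ?P" for m and e :: "nat \<Rightarrow> nat set"
    by (rule sets_PiM_I_finite) (auto simp: \<mu> D_sets)
  have T_ind: "indicator (?T m) x = (\<Sum>e\<in>?E m. indicator (PiE {..<k} (\<lambda>i. D m (e i))) x :: ennreal)"
    if "x \<in> space ?P" for m x
    unfolding D_def using that by (intro indicator_separated_tuples) (auto simp: space_PiM PiE_iff)
  have count: "of_nat (card (separated_tuples U m k (X \<omega> \<inter> B))) =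
      (\<Sum>e\<in>?E m. \<Prod>i<k. num_points (X \<omega>) (D m (e i)))" if "\<omega> \<in> space M" for \<omega> m
  proof -
    have "X \<omega> \<inter> D m v = {z \<in> X \<omega> \<inter> B. cell_code U m z = v}" for v by (auto simp: D_def)
    moreover have "finite {z \<in> X \<omega> \<inter> B. cell_code U m z = v}" for v
      by (rule finite_subset[OF _ fin[OF \<open>\<omega> \<in> space M\<close>]]) auto
    ultimately have "num_points (X \<omega>) (D m v) = of_nat (card {z \<in> X \<omega> \<inter> B. cell_code U m z = v})" for v
      by (simp add: num_points_finite)
    then show ?thesis by (simp only: card_separated_tuples[OF fin[OF that]])
  qed
  have moment: "(\<integral>\<^sup>+\<omega>. of_nat (card (separated_tuples U m k (X \<omega> \<inter> B))) \<partial>M) =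
      (\<integral>\<^sup>+x\<in>?T m. ennreal (\<rho> k x) \<partial>?P)" for m
  proof -
    have "(\<integral>\<^sup>+\<omega>. of_nat (card (separated_tuples U m k (X \<omega> \<inter> B))) \<partial>M) =
        (\<integral>\<^sup>+\<omega>. (\<Sum>e\<in>?E m. \<Prod>i<k. num_points (X \<omega>) (D m (e i))) \<partial>M)"
      by (intro nn_integral_cong count)
    also have "\<dots> = (\<Sum>e\<in>?E m. \<integral>\<^sup>+\<omega>. (\<Prod>i<k. num_points (X \<omega>) (D m (e i))) \<partial>M)"
      by (intro nn_integral_sum) measurable
    also have "\<dots> = (\<Sum>e\<in>?E m. \<integral>\<^sup>+x\<in>PiE {..<k} (\<lambda>i. D m (e i)). ennreal (\<rho> k x) \<partial>?P)"
    proof (intro sum.cong refl)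
      fix e assume "e \<in> ?E m"
      then have "disjoint_family_on (\<lambda>i. D m (e i)) {..<k}"
        by (auto simp: disjoint_family_on_def D_def inj_tuples_def inj_on_def)
      then show "(\<integral>\<^sup>+\<omega>. (\<Prod>i<k. num_points (X \<omega>) (D m (e i))) \<partial>M) =
          (\<integral>\<^sup>+x\<in>PiE {..<k} (\<lambda>i. D m (e i)). ennreal (\<rho> k x) \<partial>?P)"
        using \<rho> k D_sets by (simp add: joint_intensities_def)
    qed
    also have "\<dots> = (\<integral>\<^sup>+x. (\<Sum>e\<in>?E m. ennreal (\<rho> k x) * indicator (PiE {..<k} (\<lambda>i. D m (e i))) x) \<partial>?P)"
      by (subst nn_integral_sum) (auto intro!: borel_measurable_times_ennreal)
    also have "\<dots> = (\<integral>\<^sup>+x\<in>?T m. ennreal (\<rho> k x) \<partial>?P)"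
      by (intro nn_integral_cong) (simp add: T_ind sum_distrib_left)
    finally show ?thesis .
  qed
  have "(\<lambda>m. \<integral>\<^sup>+\<omega>. of_nat (card (separated_tuples U m k (X \<omega> \<inter> B))) * indicator (space M) \<omega> \<partial>M)
      \<longlonglongrightarrow> (\<integral>\<^sup>+\<omega>. of_nat (card (inj_tuples k (X \<omega> \<inter> B))) * indicator (space M) \<omega> \<partial>M)"
  proof (rule nn_integral_LIMSEQ)
    show "incseq (\<lambda>m \<omega>. of_nat (card (separated_tuples U m k (X \<omega> \<inter> B))) * indicator (space M) \<omega> :: ennreal)"
    proof (intro incseq_SucI le_funI)
      fix m \<omega>
      show "of_nat (card (separated_tuples U m k (X \<omega> \<inter> B))) * indicator (space M) \<omega> \<le>
          (of_nat (card (separated_tuples U (Suc m) k (X \<omega> \<inter> B))) * indicator (space M) \<omega> :: ennreal)"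
      proof (cases "\<omega> \<in> space M")
        case True
        then have "finite (separated_tuples U (Suc m) k (X \<omega> \<inter> B))"
          using fin by (simp add: separated_tuples_def finite_PiE)
        then have "card (separated_tuples U m k (X \<omega> \<inter> B)) \<le> card (separated_tuples U (Suc m) k (X \<omega> \<inter> B))"
          by (intro card_mono separated_tuples_mono) auto
        then show ?thesis by (intro mult_right_mono of_nat_mono) auto
      qed simp
    qed
  next
    fix m
    have "(\<lambda>\<omega>. (\<Sum>e\<in>?E m. \<Prod>i<k. num_points (X \<omega>) (D m (e i)))) \<in> borel_measurable M"
      by measurable
    then show "(\<lambda>\<omega>. of_nat (card (separated_tuples U m k (X \<omega> \<inter> B))) * indicator (space M) \<omega> :: ennreal) \<in> borel_measurable M"
      by (subst measurable_cong[OF arg_cong2[where f = "(*)", OF count refl]]) auto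
  next
    fix \<omega>
    show "(\<lambda>m. of_nat (card (separated_tuples U m k (X \<omega> \<inter> B))) * indicator (space M) \<omega> :: ennreal)
        \<longlonglongrightarrow> of_nat (card (inj_tuples k (X \<omega> \<inter> B))) * indicator (space M) \<omega>"
    proof (cases "\<omega> \<in> space M")
      case True
      have "\<forall>\<^sub>F m in sequentially. separated_tuples U m k (X \<omega> \<inter> B) = inj_tuples k (X \<omega> \<inter> B)"
        using sep fin[OF True] by (rule eventually_separated_tuples)
      then show ?thesis
        by (intro tendsto_eventually) (auto elim: eventually_mono)
    qed simp
  qed
  then have "(\<lambda>m. \<integral>\<^sup>+x\<in>?T m. ennreal (\<rho> k x) \<partial>?P)
      \<longlonglongrightarrow> (\<integral>\<^sup>+\<omega>. of_nat (card (inj_tuples k (X \<omega> \<inter> B))) \<partial>M)"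
    unfolding moment[symmetric] by (simp cong: nn_integral_cong)
  moreover have "(\<lambda>m. \<integral>\<^sup>+x\<in>?T m. ennreal (\<rho> k x) \<partial>?P) \<longlonglongrightarrow>
      (\<integral>\<^sup>+x\<in>{..<k} \<rightarrow>\<^sub>E B. ennreal (\<rho> k x) \<partial>?P)"
  proof (rule nn_integral_LIMSEQ)
    show "incseq (\<lambda>m x. ennreal (\<rho> k x) * indicator (?T m) x)"
      by (intro incseq_SucI le_funI mult_left_mono) (use separated_tuples_mono[OF le_SucI[OF order_refl], of U _ k B] in \<open>auto intro!: indicator_leI\<close>)
  next
    fix m
    have "(\<lambda>x. ennreal (\<rho> k x) * (\<Sum>e\<in>?E m. indicator (PiE {..<k} (\<lambda>i. D m (e i))) x)) \<in> borel_measurable ?P"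
      by measurable
    then show "(\<lambda>x. ennreal (\<rho> k x) * indicator (?T m) x) \<in> borel_measurable ?P"
      by (subst measurable_cong[OF arg_cong2[where f = "(*)", OF refl T_ind]]) auto
  next
    fix x
    show "(\<lambda>m. ennreal (\<rho> k x) * indicator (?T m) x) \<longlonglongrightarrow> ennreal (\<rho> k x) * indicator ({..<k} \<rightarrow>\<^sub>E B) x"
    proof (cases "x \<in> {..<k} \<rightarrow>\<^sub>E B \<and> inj_on x {..<k}")
      case True
      have "\<forall>\<^sub>F m in sequentially. inj_on (cell_code U m) (x ` {..<k})"
        by (rule eventually_inj_on_cell_code) (simp_all add: sep)
      then have "\<forall>\<^sub>F m in sequentially. x \<in> ?T m"
      proof eventually_elim
        case (elim m)
        have "inj_on (\<lambda>i. cell_code U m (x i)) {..<k}"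
          using comp_inj_on[OF conjunct2[OF True] elim] by (simp add: comp_def)
        then show ?case using True by (simp add: separated_tuples_def)
      qed
      then have "\<forall>\<^sub>F m in sequentially.
          ennreal (\<rho> k x) * indicator (?T m) x = ennreal (\<rho> k x) * indicator ({..<k} \<rightarrow>\<^sub>E B) x"
        by (rule eventually_mono) (simp add: conjunct1[OF True])
      then show ?thesis by (rule tendsto_eventually)
    next
      case False
      have zero: "\<rho> k x = 0" if "x \<in> {..<k} \<rightarrow>\<^sub>E B"
        using False \<rho>_zero[of x] that by (simp add: space_PiM space_\<mu> PiE_iff)
      have sub: "?T m \<subseteq> {..<k} \<rightarrow>\<^sub>E B" for m by (auto simp: separated_tuples_def)
      have vanish: "ennreal (\<rho> k x) * indicator A x = 0" if "A \<subseteq> {..<k} \<rightarrow>\<^sub>E B" for A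
        using zero that by (cases "x \<in> A") auto
      show ?thesis unfolding vanish[OF sub] vanish[OF subset_refl] by (rule tendsto_const)
    qed
  qed
  ultimately show ?thesis by (rule LIMSEQ_unique)
qed

section \<open>Void probabilities as alternating series\<close>

text \<open>
  Since \<open>(\<Sum>k. (-1) ^ k * (N choose k))\<close> is 1 for \<open>N = 0\<close> and 0 otherwise, it suffices to
  take expectations termwise; \<open>a k\<close> is the expectation of \<open>N choose k\<close>.
\<close>

theorem void_probability_sums:
  fixes X :: "'w \<Rightarrow> 'a::{second_countable_topology, t2_space} set"
  assumes X: "simple_point_process M X" and \<rho>: "joint_intensities M X \<mu> \<rho>"
    and \<mu>: "sets \<mu> = sets borel" and B: "B \<in> sets borel"
    and fin: "\<And>\<omega>. \<omega> \<in> space M \<Longrightarrow> finite (X \<omega> \<inter> B)"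
    and a0: "a 0 = 1" and a_nonneg: "\<And>k. 0 \<le> a k" and a_summable: "summable a"
    and a: "\<And>k. k \<ge> 1 \<Longrightarrow>
      (\<integral>\<^sup>+x\<in>{..<k} \<rightarrow>\<^sub>E B. ennreal (\<rho> k x) \<partial>Pi\<^sub>M {..<k} (\<lambda>_. \<mu>)) = ennreal (fact k * a k)"
  shows "(\<lambda>k. (-1) ^ k * a k) sums measure M {\<omega> \<in> space M. num_points (X \<omega>) B = 0}"
proof -
  interpret prob_space M using X by (simp add: simple_point_process_def)
  define n where "n \<omega> = card (X \<omega> \<inter> B)" for \<omega>
  have num: "num_points (X \<omega>) B = ennreal (real (n \<omega>))" if "\<omega> \<in> space M" for \<omega>
    using fin[OF that] by (simp add: num_points_finite n_def ennreal_of_nat_eq_real_of_nat)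
  have [measurable]: "(\<lambda>\<omega>. num_points (X \<omega>) B) \<in> borel_measurable M"
    using X B by (simp add: simple_point_process_def)
  have "(\<lambda>\<omega>. nat \<lfloor>enn2real (num_points (X \<omega>) B)\<rfloor>) \<in> measurable M (count_space UNIV)"
    by measurable
  then have [measurable]: "n \<in> measurable M (count_space UNIV)"
    by (rule measurable_cong[THEN iffD1, rotated]) (simp add: num)
  have moment: "(\<integral>\<^sup>+\<omega>. ennreal (real (n \<omega> choose k)) \<partial>M) = ennreal (a k)" for k
  proof (cases "k = 0")
    case True
    then show ?thesis using a0 by (simp add: emeasure_space_1)
  next
    case False
    have "ennreal (fact k) * (\<integral>\<^sup>+\<omega>. ennreal (real (n \<omega> choose k)) \<partial>M) =
        (\<integral>\<^sup>+\<omega>. ennreal (fact k) * ennreal (real (n \<omega> choose k)) \<partial>M)"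
      by (subst nn_integral_cmult) measurable
    also have "\<dots> = (\<integral>\<^sup>+\<omega>. of_nat (card (inj_tuples k (X \<omega> \<inter> B))) \<partial>M)"
    proof (rule nn_integral_cong)
      fix \<omega> assume "\<omega> \<in> space M"
      then have "real (card (inj_tuples k (X \<omega> \<inter> B))) = fact k * real (n \<omega> choose k)"
        using fin by (simp add: card_inj_tuples n_def)
      then have "ennreal (real (card (inj_tuples k (X \<omega> \<inter> B)))) = ennreal (fact k) * ennreal (real (n \<omega> choose k))"
        by (simp only: ennreal_mult[OF fact_ge_zero of_nat_0_le_iff])
      then show "ennreal (fact k) * ennreal (real (n \<omega> choose k)) = of_nat (card (inj_tuples k (X \<omega> \<inter> B)))"
        by (simp only: ennreal_of_nat_eq_real_of_nat)
    qed
    also have "\<dots> = ennreal (fact k * a k)"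
      using factorial_moment[OF X \<rho> \<mu> B fin, of k] a[of k] False by simp
    also have "\<dots> = ennreal (fact k) * ennreal (a k)" by (simp add: ennreal_mult a_nonneg)
    finally show ?thesis by (subst (asm) ennreal_mult_cancel_left) simp
  qed
  have integrable: "integrable M (\<lambda>\<omega>. real (n \<omega> choose k))" for k
    by (rule integrableI_nonneg) (auto simp: moment)
  have integral: "(\<integral>\<omega>. real (n \<omega> choose k) \<partial>M) = a k" for k
    by (rule integral_eq_nn_integral[THEN trans]) (simp_all add: moment a_nonneg)
  have support: "(\<lambda>k. (-1) ^ k * real (m choose k)) sums (\<Sum>k\<le>m. (-1) ^ k * real (m choose k))" for m
    by (rule sums_finite) (auto simp: binomial_eq_0)
  have alternating: "(\<Sum>k. (-1) ^ k * real (m choose k)) = of_bool (m = 0)" for m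
    using sums_unique[OF support[of m]] choose_alternating_sum[of m, where 'a = real] by (cases "m = 0") auto
  have "(\<lambda>k. \<integral>\<omega>. (-1) ^ k * real (n \<omega> choose k) \<partial>M) sums
      (\<integral>\<omega>. (\<Sum>k. (-1) ^ k * real (n \<omega> choose k)) \<partial>M)"
  proof (rule sums_integral)
    show "integrable M (\<lambda>\<omega>. (-1) ^ k * real (n \<omega> choose k))" for k using integrable by simp
    show "AE \<omega> in M. summable (\<lambda>k. norm ((-1) ^ k * real (n \<omega> choose k)))"
    proof (rule AE_I2)
      fix \<omega>
      show "summable (\<lambda>k. norm ((-1) ^ k * real (n \<omega> choose k)))"
        by (rule summable_finite[of "{..n \<omega>}"]) (auto simp: binomial_eq_0)
    qed
    have "norm ((-1) ^ k * real m) = real m" for k m by (simp add: abs_mult power_abs)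
    then show "summable (\<lambda>k. \<integral>\<omega>. norm ((-1) ^ k * real (n \<omega> choose k)) \<partial>M)"
      using a_summable by (simp only: integral)
  qed
  also have "(\<lambda>k. \<integral>\<omega>. (-1) ^ k * real (n \<omega> choose k) \<partial>M) = (\<lambda>k. (-1) ^ k * a k)"
    by (simp add: integral)
  also have "(\<integral>\<omega>. (\<Sum>k. (-1) ^ k * real (n \<omega> choose k)) \<partial>M) =
      (\<integral>\<omega>. indicator {\<omega> \<in> space M. num_points (X \<omega>) B = 0} \<omega> \<partial>M)"
    unfolding alternating by (intro Bochner_Integration.integral_cong) (auto simp: num indicator_def)
  also have "\<dots> = measure M {\<omega> \<in> space M. num_points (X \<omega>) B = 0}"
    by (simp add: Int_def conj_commute)
  finally show ?thesis .
qed

section \<open>Determinants of finite-rank kernels\<close>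

lemma det_mat_expand:
  "Determinant.det (Matrix.mat k k (\<lambda>(i, j). K i j)) =
    (\<Sum>p | p permutes {..<k}. of_int (sign p) * (\<Prod>i<k. K i (p i) :: 'a::comm_ring_1))"
proof -
  have "p i < k" if "p permutes {..<k}" "i < k" for p i
    using permutes_in_image[OF that(1), of i] that(2) by simp
  then show ?thesis
    by (subst Determinant.det_def'[of _ k]) (auto simp: lessThan_atLeast0 intro!: sum.cong prod.cong)
qed

text \<open>
  The sum is the determinant of the matrix with entries \<open>l (f i)\<close> where \<open>f i = f j\<close> and 0
  elsewhere. If \<open>f\<close> is injective, this matrix is diagonal; otherwise it has two equal rows.
\<close>

lemma sum_sign_fixing:
  fixes l :: "'a \<Rightarrow> 'b::comm_ring_1" and f :: "nat \<Rightarrow> 'a"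
  shows "(\<Sum>p | p permutes {..<k}. of_int (sign p) * (\<Prod>i<k. if f i = f (p i) then l (f i) else 0)) =
    (if inj_on f {..<k} then \<Prod>i<k. l (f i) else 0)"
proof -
  let ?A = "Matrix.mat k k (\<lambda>(i, j). if f i = f j then l (f i) else 0)"
  have "Determinant.det ?A = (if inj_on f {..<k} then \<Prod>i<k. l (f i) else 0)"
  proof (cases "inj_on f {..<k}")
    case True
    have "upper_triangular ?A"
      using inj_onD[OF True] by (fastforce simp: upper_triangular_def)
    then have "Determinant.det ?A = prod_list (diag_mat ?A)"
      by (rule det_upper_triangular[of _ k]) simp
    also have "\<dots> = (\<Prod>i<k. l (f i))"
      by (simp add: prod_list_diag_prod lessThan_atLeast0)
    finally show ?thesis using True by simp
  next
    case False
    then obtain i j where ij: "i < k" "j < k" "f i = f j" "i \<noteq> j"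
      by (auto simp: inj_on_def)
    have "Determinant.det ?A = 0"
      by (rule det_identical_rows[of _ k i j]) (use ij in \<open>auto intro!: eq_vecI\<close>)
    then show ?thesis using False by simp
  qed
  then show ?thesis by (simp only: det_mat_expand)
qed

text \<open>
  The factors are regrouped so that the \<open>i\<close>-th one depends on the single variable \<open>x (p i)\<close>; the
  integral over the product space can then be taken one variable at a time.
\<close>

lemma det_finite_rank_expand:
  fixes \<phi> \<psi> :: "'b \<Rightarrow> 'a \<Rightarrow> 'c::comm_ring_1"
  assumes A: "finite A"
  shows "Determinant.det (Matrix.mat k k (\<lambda>(i, j). \<Sum>a\<in>A. \<phi> a (x i) * \<psi> a (x j))) =
    (\<Sum>p | p permutes {..<k}. \<Sum>f\<in>{..<k} \<rightarrow>\<^sub>E A.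
       of_int (sign p) * (\<Prod>i<k. \<phi> (f (p i)) (x (p i)) * \<psi> (f i) (x (p i))))"
proof -
  have "(\<Prod>i<k. \<Sum>a\<in>A. \<phi> a (x i) * \<psi> a (x (p i))) =
      (\<Sum>f\<in>{..<k} \<rightarrow>\<^sub>E A. \<Prod>i<k. \<phi> (f (p i)) (x (p i)) * \<psi> (f i) (x (p i)))"
    if p: "p permutes {..<k}" for p
  proof -
    have "(\<Prod>i<k. \<Sum>a\<in>A. \<phi> a (x i) * \<psi> a (x (p i))) =
        (\<Sum>f\<in>{..<k} \<rightarrow>\<^sub>E A. \<Prod>i<k. \<phi> (f i) (x i) * \<psi> (f i) (x (p i)))"
      by (rule prod_sum_PiE) (use A in auto)
    also have "\<dots> = (\<Sum>f\<in>{..<k} \<rightarrow>\<^sub>E A. \<Prod>i<k. \<phi> (f (p i)) (x (p i)) * \<psi> (f i) (x (p i)))"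
    proof (intro sum.cong refl)
      fix f
      have "(\<Prod>i<k. \<phi> (f i) (x i)) = (\<Prod>i<k. \<phi> (f (p i)) (x (p i)))"
        using prod.permute[OF p, of "\<lambda>i. \<phi> (f i) (x i)"] by (simp add: comp_def)
      then show "(\<Prod>i<k. \<phi> (f i) (x i) * \<psi> (f i) (x (p i))) =
          (\<Prod>i<k. \<phi> (f (p i)) (x (p i)) * \<psi> (f i) (x (p i)))"
        by (simp add: prod.distrib)
    qed
    finally show ?thesis .
  qed
  then show ?thesis by (simp add: det_mat_expand sum_distrib_left)
qed

text \<open>
  For a kernel of finite rank with an orthogonal expansion, the integral of the \<open>k\<close>-point
  determinant is \<open>k!\<close> times the \<open>k\<close>-th elementary symmetric function of the squared norms.
\<close>

lemma integral_det_finite_rank: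
  fixes \<phi> :: "nat \<Rightarrow> 'a \<Rightarrow> complex"
  assumes \<mu>: "sigma_finite_measure \<mu>" and A: "finite A"
    and int: "\<And>a b. a \<in> A \<Longrightarrow> b \<in> A \<Longrightarrow> integrable \<mu> (\<lambda>z. \<phi> a z * cnj (\<phi> b z))"
    and orth: "\<And>a b. a \<in> A \<Longrightarrow> b \<in> A \<Longrightarrow>
      (\<integral>z. \<phi> a z * cnj (\<phi> b z) \<partial>\<mu>) = (if a = b then complex_of_real (l a) else 0)"
  defines "d \<equiv> (\<lambda>k x. Determinant.det (Matrix.mat k k (\<lambda>(i, j). \<Sum>a\<in>A. \<phi> a (x i) * cnj (\<phi> a (x j)))))"
  shows "integrable (Pi\<^sub>M {..<k} (\<lambda>_. \<mu>)) (d k)"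
    and "(\<integral>x. d k x \<partial>Pi\<^sub>M {..<k} (\<lambda>_. \<mu>)) =
      complex_of_real (\<Sum>f\<in>inj_tuples k A. \<Prod>i<k. l (f i))"
proof -
  interpret sigma_finite_measure \<mu> by fact
  interpret P: product_sigma_finite "\<lambda>_. \<mu>" by standard
  let ?P = "Pi\<^sub>M {..<k} (\<lambda>_. \<mu>)"
  have reindex: "(\<Prod>i<k. g (p i)) = (\<Prod>i<k. g i)" if "p permutes {..<k}" for g :: "nat \<Rightarrow> complex" and p
    using prod.permute[OF that, of g] by (simp add: comp_def)
  have fin: "finite ({..<k} \<rightarrow>\<^sub>E A)" using A by (simp add: finite_PiE)
  have summand: "has_bochner_integral ?P
      (\<lambda>x. \<Prod>i<k. \<phi> (f (p i)) (x (p i)) * cnj (\<phi> (f i) (x (p i))))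
      (\<Prod>i<k. if f i = f (p i) then complex_of_real (l (f i)) else 0)"
    if p: "p permutes {..<k}" and f: "f \<in> {..<k} \<rightarrow>\<^sub>E A" for p f
  proof -
    let ?q = "Hilbert_Choice.inv p"
    let ?g = "\<lambda>i z. \<phi> (f i) z * cnj (\<phi> (f (?q i)) z)"
    have q: "?q i \<in> {..<k}" if "i \<in> {..<k}" for i
      using permutes_in_image[OF permutes_inv[OF p], of i] that by simp
    have mem: "f i \<in> A" "f (?q i) \<in> A" if "i \<in> {..<k}" for i using f that q by auto
    have "(\<Prod>i<k. \<phi> (f (p i)) (x (p i)) * cnj (\<phi> (f i) (x (p i)))) = (\<Prod>i<k. ?g i (x i))" for x
      using reindex[OF p, of "\<lambda>i. ?g i (x i)"] by (simp add: permutes_inverses[OF p])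
    moreover have "(\<Prod>i<k. if f i = f (p i) then complex_of_real (l (f i)) else 0) =
        (\<Prod>i<k. \<integral>z. ?g i z \<partial>\<mu>)"
    proof -
      have "(\<Prod>i<k. \<integral>z. ?g i z \<partial>\<mu>) = (\<Prod>i<k. if f i = f (?q i) then complex_of_real (l (f i)) else 0)"
        by (intro prod.cong refl orth) (use mem in auto)
      also have "\<dots> = (\<Prod>i<k. if f (p i) = f i then complex_of_real (l (f (p i))) else 0)"
        using reindex[OF p, of "\<lambda>i. if f i = f (?q i) then complex_of_real (l (f i)) else 0"]
        by (simp add: permutes_inverses[OF p])
      also have "\<dots> = (\<Prod>i<k. if f i = f (p i) then complex_of_real (l (f i)) else 0)"
        by (intro prod.cong) auto
      finally show ?thesis by simp
    qed
    moreover have "has_bochner_integral ?P (\<lambda>x. \<Prod>i<k. ?g i (x i)) (\<Prod>i<k. \<integral>z. ?g i z \<partial>\<mu>)"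
      unfolding has_bochner_integral_iff
      using P.product_integrable_prod[of "{..<k}" ?g] P.product_integral_prod[of "{..<k}" ?g] int mem
      by auto
    ultimately show ?thesis by simp
  qed
  have "has_bochner_integral ?P (d k)
      (\<Sum>p | p permutes {..<k}. \<Sum>f\<in>{..<k} \<rightarrow>\<^sub>E A.
        of_int (sign p) * (\<Prod>i<k. if f i = f (p i) then complex_of_real (l (f i)) else 0))"
    unfolding d_def det_finite_rank_expand[OF A, where \<phi> = \<phi> and \<psi> = "\<lambda>a z. cnj (\<phi> a z)"]
    by (intro has_bochner_integral_sum has_bochner_integral_mult_right summand) auto
  also have "(\<Sum>p | p permutes {..<k}. \<Sum>f\<in>{..<k} \<rightarrow>\<^sub>E A.
        of_int (sign p) * (\<Prod>i<k. if f i = f (p i) then complex_of_real (l (f i)) else 0)) =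
      (\<Sum>f\<in>{..<k} \<rightarrow>\<^sub>E A. if inj_on f {..<k} then \<Prod>i<k. complex_of_real (l (f i)) else 0)"
    by (subst sum.swap)
      (intro sum.cong refl sum_sign_fixing[where l = "\<lambda>a. complex_of_real (l a)"])
  also have "\<dots> = complex_of_real (\<Sum>f\<in>inj_tuples k A. \<Prod>i<k. l (f i))"
    using fin
    by (simp add: inj_tuples_def sum.inter_filter if_distrib[of complex_of_real] cong: if_cong)
  finally show "integrable ?P (d k)" "(\<integral>x. d k x \<partial>?P) =
      complex_of_real (\<Sum>f\<in>inj_tuples k A. \<Prod>i<k. l (f i))"
    by (simp_all add: has_bochner_integral_iff)
qed

lemma norm_det_mat_le:
  fixes K :: "nat \<Rightarrow> nat \<Rightarrow> complex"
  assumes "\<And>i j. i < k \<Longrightarrow> j < k \<Longrightarrow> cmod (K i j) \<le> c i"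
  shows "cmod (Determinant.det (Matrix.mat k k (\<lambda>(i, j). K i j))) \<le> fact k * (\<Prod>i<k. c i)"
proof -
  have "cmod (of_int (sign p) * (\<Prod>i<k. K i (p i))) \<le> (\<Prod>i<k. c i)" if p: "p permutes {..<k}" for p
  proof -
    have "(\<Prod>i<k. cmod (K i (p i))) \<le> (\<Prod>i<k. c i)"
      using assms permutes_in_image[OF p] by (intro prod_mono) auto
    then show ?thesis by (simp add: norm_mult prod_norm sign_def)
  qed
  then have "cmod (\<Sum>p | p permutes {..<k}. of_int (sign p) * (\<Prod>i<k. K i (p i))) \<le>
      of_nat (card {p. p permutes {..<k}}) * (\<Prod>i<k. c i)"
    by (intro sum_norm_bound) auto
  then show ?thesis by (simp add: det_mat_expand card_permutations)
qed

section \<open>Kernels with an orthogonal expansion\<close>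

text \<open>
  A kernel \<open>(\<Sum>a. \<phi> a z * cnj (\<phi> a w))\<close> on a set \<open>B\<close> of finite measure, where the functions
  \<open>\<phi> a\<close> vanish off \<open>B\<close>, are orthogonal with squared norms \<open>l a\<close>, and are bounded by constants
  \<open>b a\<close> that are square summable. The bounds make the expansion converge uniformly and allow
  dominated convergence everywhere below.
\<close>

locale trace_class_kernel = sigma_finite_measure \<mu> for \<mu> :: "'a measure" +
  fixes \<phi> :: "nat \<Rightarrow> 'a \<Rightarrow> complex" and B :: "'a set" and b :: "nat \<Rightarrow> real" and l :: "nat \<Rightarrow> real"
  assumes measurable_\<phi> [measurable]: "\<And>a. \<phi> a \<in> borel_measurable \<mu>"
    and B [measurable]: "B \<in> sets \<mu>" and B_finite: "emeasure \<mu> B < \<infinity>"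
    and \<phi>_bound: "\<And>a z. z \<in> B \<Longrightarrow> cmod (\<phi> a z) \<le> b a"
    and \<phi>_outside: "\<And>a z. z \<notin> B \<Longrightarrow> \<phi> a z = 0"
    and b_summable: "summable (\<lambda>a. (b a)\<^sup>2)"
    and orthogonal: "\<And>a c. (\<integral>z. \<phi> a z * cnj (\<phi> c z) \<partial>\<mu>) = (if a = c then complex_of_real (l a) else 0)"
begin

lemma product_bound: "cmod (\<phi> a z * cnj (\<phi> a w)) \<le> (b a)\<^sup>2 * indicator B z"
proof (cases "z \<in> B \<and> w \<in> B")
  case True
  then show ?thesis
    using mult_mono[OF \<phi>_bound[of z a] \<phi>_bound[of w a]] order_trans[OF norm_ge_zero \<phi>_bound[of z a]]
    by (simp add: norm_mult power2_eq_square)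
qed (auto simp: \<phi>_outside)

lemma integrable_products: "integrable \<mu> (\<lambda>z. \<phi> a z * cnj (\<phi> c z))"
proof (rule Bochner_Integration.integrable_bound)
  show "integrable \<mu> (\<lambda>z. b a * b c * indicator B z)"
    using B_finite by (intro integrable_mult_right integrable_real_indicator) auto
  have "cmod (\<phi> a z) * cmod (\<phi> c z) \<le> \<bar>b a\<bar> * \<bar>b c\<bar>" if "z \<in> B" for z
    using \<phi>_bound[OF that, of a] \<phi>_bound[OF that, of c] by (intro mult_mono) auto
  then show "AE z in \<mu>. norm (\<phi> a z * cnj (\<phi> c z)) \<le> norm (b a * b c * indicator B z)"
    by (intro AE_I2) (auto simp: norm_mult \<phi>_outside indicator_def abs_mult)
  show "(\<lambda>z. \<phi> a z * cnj (\<phi> c z)) \<in> borel_measurable \<mu>"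
    by (intro borel_measurable_times measurable_\<phi>
        borel_measurable_continuous_on[OF continuous_on_cnj[OF continuous_on_id]])
qed

lemma l_eq: "l a = (\<integral>z. (cmod (\<phi> a z))\<^sup>2 \<partial>\<mu>)"
proof -
  have "complex_of_real (l a) = (\<integral>z. \<phi> a z * cnj (\<phi> a z) \<partial>\<mu>)" by (simp add: orthogonal)
  also have "\<dots> = complex_of_real (\<integral>z. (cmod (\<phi> a z))\<^sup>2 \<partial>\<mu>)"
    by (simp only: complex_norm_square[symmetric] integral_complex_of_real)
  finally show ?thesis using of_real_eq_iff by blast
qed

lemma l_nonneg: "0 \<le> l a"
  by (simp add: l_eq)

lemma l_le: "l a \<le> (b a)\<^sup>2 * measure \<mu> B"
proof -
  have "(\<integral>z. (cmod (\<phi> a z))\<^sup>2 \<partial>\<mu>) \<le> (\<integral>z. (b a)\<^sup>2 * indicator B z \<partial>\<mu>)"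
  proof (rule integral_mono)
    show "integrable \<mu> (\<lambda>z. (cmod (\<phi> a z))\<^sup>2)"
      using integrable_norm[OF integrable_products[of a a]] by (simp add: norm_mult power2_eq_square)
    show "integrable \<mu> (\<lambda>z. (b a)\<^sup>2 * indicator B z)"
      using B_finite by (intro integrable_mult_right integrable_real_indicator) auto
    show "(cmod (\<phi> a z))\<^sup>2 \<le> (b a)\<^sup>2 * indicator B z" for z
      using product_bound[of a z z] by (simp add: norm_mult power2_eq_square)
  qed
  then show ?thesis by (simp add: l_eq)
qed

lemma l_summable: "summable l"
  by (rule summable_comparison_test'[OF summable_mult2[OF b_summable, of "measure \<mu> B"]])
    (simp add: l_nonneg l_le)

definition kernel :: "'a \<Rightarrow> 'a \<Rightarrow> complex" where
  "kernel z w = (\<Sum>a. \<phi> a z * cnj (\<phi> a w))"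

lemma kernel_summable: "summable (\<lambda>a. \<phi> a z * cnj (\<phi> a w))"
proof (rule summable_comparison_test'[OF b_summable])
  fix a
  show "norm (\<phi> a z * cnj (\<phi> a w)) \<le> (b a)\<^sup>2"
    by (rule order_trans[OF product_bound]) (simp add: indicator_def)
qed

text \<open>
  The \<open>k\<close>-point determinant of the kernel.
\<close>

definition minor :: "nat \<Rightarrow> (nat \<Rightarrow> 'a) \<Rightarrow> complex" where
  "minor k x = Determinant.det (Matrix.mat k k (\<lambda>(i, j). kernel (x i) (x j)))"

lemma minor_outside:
  assumes "i < k" "x i \<notin> B"
  shows "minor k x = 0"
  unfolding minor_def kernel_def det_mat_expand
proof (intro sum.neutral ballI)
  fix p
  have "(\<Prod>i<k. \<Sum>a. \<phi> a (x i) * cnj (\<phi> a (x (p i)))) = 0"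
    using assms by (intro prod_zero bexI[of _ i]) (auto simp: \<phi>_outside)
  then show "of_int (sign p) * (\<Prod>i<k. \<Sum>a. \<phi> a (x i) * cnj (\<phi> a (x (p i)))) = 0" by simp
qed

text \<open>
  The \<open>k\<close>-th elementary symmetric function of \<open>l 0, ..., l (J - 1)\<close>; each set of \<open>k\<close> indices is the
  range of \<open>k!\<close> injective tuples.
\<close>

definition elem_sym :: "nat \<Rightarrow> nat \<Rightarrow> real" where
  "elem_sym J k = (\<Sum>f\<in>inj_tuples k {..<J}. \<Prod>i<k. l (f i)) / fact k"

lemma elem_sym_bound: "\<bar>elem_sym J k\<bar> \<le> suminf l ^ k / fact k"
proof -
  have "(\<Sum>f\<in>inj_tuples k {..<J}. \<Prod>i<k. l (f i)) \<le> (\<Sum>f\<in>{..<k} \<rightarrow>\<^sub>E {..<J}. \<Prod>i<k. l (f i))"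
    by (intro sum_mono2) (auto simp: inj_tuples_def finite_PiE l_nonneg prod_nonneg)
  also have "\<dots> = (\<Prod>i<k. \<Sum>a<J. l a)" by (rule prod_sum_PiE[symmetric]) auto
  also have "\<dots> \<le> suminf l ^ k"
    using sum_le_suminf[OF l_summable, of "{..<J}"] by (auto simp: l_nonneg sum_nonneg intro!: power_mono)
  finally show ?thesis
    by (simp add: elem_sym_def divide_right_mono sum_nonneg prod_nonneg l_nonneg)
qed

lemma elem_sym_alternating_sum: "(\<Sum>k. (-1) ^ k * elem_sym J k) = (\<Prod>a<J. 1 - l a)"
proof -
  have "(\<Sum>k. (-1) ^ k * elem_sym J k) = (\<Sum>k\<le>J. (-1) ^ k * elem_sym J k)"
    by (rule suminf_finite) (auto simp: elem_sym_def inj_tuples_eq_empty)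
  then show ?thesis using prod_one_minus_eq_sum_inj_tuples[of "{..<J}" l]
    by (simp add: elem_sym_def)
qed

lemma integral_minor:
  shows "integrable (Pi\<^sub>M {..<k} (\<lambda>_. \<mu>)) (minor k)"
    and "(\<lambda>J. complex_of_real (fact k * elem_sym J k)) \<longlonglongrightarrow> (\<integral>x. minor k x \<partial>Pi\<^sub>M {..<k} (\<lambda>_. \<mu>))"
proof -
  interpret P: product_sigma_finite "\<lambda>_. \<mu>" by standard
  let ?P = "Pi\<^sub>M {..<k} (\<lambda>_. \<mu>)"
  let ?K = "\<lambda>J z w. \<Sum>a<J. \<phi> a z * cnj (\<phi> a w)"
  let ?d = "\<lambda>J x. Determinant.det (Matrix.mat k k (\<lambda>(i, j). ?K J (x i) (x j)))"
  let ?C = "suminf (\<lambda>a. (b a)\<^sup>2)"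
  note finite_rank = integral_det_finite_rank[OF sigma_finite_measure_axioms finite_lessThan
      integrable_products orthogonal]
  have lim: "(\<lambda>J. ?d J x) \<longlonglongrightarrow> minor k x" for x
    unfolding minor_def det_mat_expand kernel_def
    by (intro tendsto_intros summable_LIMSEQ kernel_summable)
  have d_meas: "?d J \<in> borel_measurable ?P" for J
    using finite_rank(1) by (rule borel_measurable_integrable)
  have minor_meas: "minor k \<in> borel_measurable ?P"
    by (rule borel_measurable_LIMSEQ_metric[OF d_meas lim])
  have dom: "integrable ?P (\<lambda>x. fact k * (\<Prod>i<k. ?C * indicator B (x i)))"
    using B_finite
    by (intro integrable_mult_right P.product_integrable_prod integrable_real_indicator) auto
  have bound: "AE x in ?P. norm (?d J x) \<le> fact k * (\<Prod>i<k. ?C * indicator B (x i))" for J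
  proof (intro AE_I2 norm_det_mat_le)
    fix x :: "nat \<Rightarrow> 'a" and i j
    have "cmod (?K J (x i) (x j)) \<le> (\<Sum>a<J. (b a)\<^sup>2 * indicator B (x i))"
      by (intro sum_norm_le product_bound)
    also have "\<dots> = (\<Sum>a<J. (b a)\<^sup>2) * indicator B (x i)" by (simp add: sum_distrib_right)
    also have "\<dots> \<le> ?C * indicator B (x i)"
      by (intro mult_right_mono sum_le_suminf b_summable) auto
    finally show "cmod (?K J (x i) (x j)) \<le> ?C * indicator B (x i)" .
  qed
  show "integrable ?P (minor k)"
    by (rule integrable_dominated_convergence[OF minor_meas d_meas dom AE_I2[OF lim] bound])
  have "(\<lambda>J. \<integral>x. ?d J x \<partial>?P) \<longlonglongrightarrow> (\<integral>x. minor k x \<partial>?P)"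
    by (rule integral_dominated_convergence[OF minor_meas d_meas dom AE_I2[OF lim] bound])
  then show "(\<lambda>J. complex_of_real (fact k * elem_sym J k)) \<longlonglongrightarrow> (\<integral>x. minor k x \<partial>?P)"
    by (simp add: finite_rank(2) elem_sym_def)
qed

end

text \<open>
  The void probability of \<open>B\<close> is the Fredholm determinant of the kernel on \<open>B\<close>, that is the
  product of \<open>1 - l a\<close>. For the truncation at \<open>J\<close> the alternating series of elementary symmetric
  functions is the product over \<open>a < J\<close>; Tannery's theorem lets \<open>J\<close> tend to infinity, because the
  \<open>k\<close>-th term is bounded by \<open>(\<Sum>a. l a) ^ k / k!\<close>. The sort constraint on the points is only
  needed for the process, so the statement is placed outside the locale.
\<close>

theorem void_probability_product:
  fixes X :: "'w \<Rightarrow> 'a::{second_countable_topology, t2_space} set" and \<mu> :: "'a measure"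
  assumes K: "trace_class_kernel \<mu> \<phi> B b l"
    and X: "simple_point_process M X" and \<rho>: "joint_intensities M X \<mu> \<rho>"
    and \<mu>: "sets \<mu> = sets borel" and fin: "\<And>\<omega>. \<omega> \<in> space M \<Longrightarrow> finite (X \<omega> \<inter> B)"
    and det: "\<And>k x. k \<ge> 1 \<Longrightarrow> x \<in> {..<k} \<rightarrow>\<^sub>E B \<Longrightarrow>
      complex_of_real (\<rho> k x) = trace_class_kernel.minor \<phi> k x"
  shows "(\<lambda>J. \<Prod>a<J. 1 - l a) \<longlonglongrightarrow> measure M {\<omega> \<in> space M. num_points (X \<omega>) B = 0}"
proof -
  interpret trace_class_kernel \<mu> \<phi> B b l by fact
  let ?P = "\<lambda>k. Pi\<^sub>M {..<k} (\<lambda>_. \<mu>)"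
  define a where "a k = (\<integral>x. Re (minor k x) \<partial>?P k) / fact k" for k
  let ?S = "suminf l"
  have lim: "(\<lambda>J. elem_sym J k) \<longlonglongrightarrow> a k" for k
  proof -
    have "(\<lambda>J. Re (complex_of_real (fact k * elem_sym J k)) / fact k) \<longlonglongrightarrow> Re (\<integral>x. minor k x \<partial>?P k) / fact k"
      by (intro tendsto_intros integral_minor) simp
    then show ?thesis by (simp add: a_def integral_Re integral_minor(1))
  qed
  have a0: "a 0 = 1"
  proof (rule LIMSEQ_unique[OF lim])
    show "(\<lambda>J. elem_sym J 0) \<longlonglongrightarrow> 1"
      by (simp add: elem_sym_def card_inj_tuples)
  qed
  have a_nonneg: "0 \<le> a k" for k
    by (rule LIMSEQ_le_const[OF lim])
      (auto simp: elem_sym_def intro!: divide_nonneg_pos sum_nonneg prod_nonneg l_nonneg)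
  have exp_summable: "summable (\<lambda>k. ?S ^ k / fact k)"
    using summable_exp[of ?S] by (simp add: field_simps)
  have a_bound: "\<bar>a k\<bar> \<le> ?S ^ k / fact k" for k
    by (rule LIMSEQ_le_const2[OF tendsto_rabs[OF lim]]) (use elem_sym_bound in blast)
  have a_summable: "summable a"
    by (rule summable_comparison_test'[OF exp_summable]) (use a_bound in simp)
  have "(\<integral>\<^sup>+x\<in>{..<k} \<rightarrow>\<^sub>E B. ennreal (\<rho> k x) \<partial>?P k) = ennreal (fact k * a k)" if k: "k \<ge> 1" for k
  proof -
    have eq: "ennreal (\<rho> k x) * indicator ({..<k} \<rightarrow>\<^sub>E B) x = ennreal (Re (minor k x))"
      and nonneg: "0 \<le> Re (minor k x)" if x: "x \<in> space (?P k)" for x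
    proof -
      have "0 \<le> \<rho> k x" using \<rho> k x by (simp add: joint_intensities_def)
      moreover have "Re (minor k x) = (if x \<in> {..<k} \<rightarrow>\<^sub>E B then \<rho> k x else 0)"
      proof (cases "x \<in> {..<k} \<rightarrow>\<^sub>E B")
        case True
        then show ?thesis using det[OF k True] by (metis Re_complex_of_real)
      next
        case False
        then obtain i where "i < k" "x i \<notin> B" using x by (auto simp: space_PiM PiE_iff)
        then show ?thesis using False minor_outside by simp
      qed
      ultimately show "ennreal (\<rho> k x) * indicator ({..<k} \<rightarrow>\<^sub>E B) x = ennreal (Re (minor k x))"
        "0 \<le> Re (minor k x)" by (auto simp: indicator_def)
    qed
    have "(\<integral>\<^sup>+x\<in>{..<k} \<rightarrow>\<^sub>E B. ennreal (\<rho> k x) \<partial>?P k) = (\<integral>\<^sup>+x. ennreal (Re (minor k x)) \<partial>?P k)"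
      by (intro nn_integral_cong eq)
    also have "\<dots> = ennreal (\<integral>x. Re (minor k x) \<partial>?P k)"
      by (intro nn_integral_eq_integral integrable_Re integral_minor(1) AE_I2 nonneg)
    finally show ?thesis by (simp add: a_def)
  qed
  then have "(\<lambda>k. (-1) ^ k * a k) sums measure M {\<omega> \<in> space M. num_points (X \<omega>) B = 0}"
    using B by (intro void_probability_sums[OF X \<rho> \<mu> _ fin a0 a_nonneg a_summable]) (simp_all add: \<mu>)
  moreover have "(\<lambda>J. \<Sum>k. (-1) ^ k * elem_sym J k) \<longlonglongrightarrow> (\<Sum>k. (-1) ^ k * a k)"
  proof (rule tannerys_theorem[THEN conjunct2, THEN conjunct2])
    show "(\<lambda>J. (-1) ^ k * elem_sym J k) \<longlonglongrightarrow> (-1) ^ k * a k" for k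
      by (intro tendsto_intros lim)
    have "norm ((-1) ^ k * elem_sym J k) \<le> ?S ^ k / fact k" for k J
      using elem_sym_bound[of J k] by (simp add: abs_mult power_abs)
    then show "\<forall>\<^sub>F (k, J) in at_top \<times>\<^sub>F sequentially. norm ((-1) ^ k * elem_sym J k) \<le> ?S ^ k / fact k"
      by (intro always_eventually) auto
  qed (use exp_summable in simp_all)
  ultimately show ?thesis by (simp add: elem_sym_alternating_sum sums_iff)
qed

section \<open>Lebesgue measure on the complex plane\<close>

lemma lborel_complex_eq_distr_pair:
  "(lborel :: complex measure) = distr (lborel \<Otimes>\<^sub>M lborel) borel (\<lambda>(x, y). Complex x y)"
proof (rule lborel_eqI)
  have meas: "(\<lambda>(x, y). Complex x y) \<in> borel_measurable (lborel \<Otimes>\<^sub>M lborel)"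
    unfolding Complex_eq by measurable
  fix l u :: complex assume le: "\<And>b. b \<in> Basis \<Longrightarrow> l \<bullet> b \<le> u \<bullet> b"
  have le': "Re l \<le> Re u" "Im l \<le> Im u" using le[of 1] le[of \<i>] by (auto simp: Basis_complex_def)
  have "(\<lambda>(x, y). Complex x y) -` box l u \<inter> space (lborel \<Otimes>\<^sub>M lborel) =
      {Re l <..< Re u} \<times> {Im l <..< Im u}"
    by (auto simp: space_pair_measure mem_box Basis_complex_def)
  then have "emeasure (distr (lborel \<Otimes>\<^sub>M lborel) borel (\<lambda>(x, y). Complex x y)) (box l u) =
      emeasure (lborel \<Otimes>\<^sub>M lborel) ({Re l <..< Re u} \<times> {Im l <..< Im u})"
    using meas by (simp add: emeasure_distr)
  also have "\<dots> = ennreal (Re u - Re l) * ennreal (Im u - Im l)"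
    using le' by (simp add: lborel.emeasure_pair_measure_Times)
  also have "\<dots> = (\<Prod>b\<in>Basis. (u - l) \<bullet> b)"
    using le' by (simp add: Basis_complex_def ennreal_mult)
  finally show "emeasure (distr (lborel \<Otimes>\<^sub>M lborel) borel (\<lambda>(x, y). Complex x y)) (box l u) =
      (\<Prod>b\<in>Basis. (u - l) \<bullet> b)" .
qed simp

lemma
  fixes f :: "complex \<Rightarrow> ennreal"
  assumes f: "f \<in> borel_measurable borel"
  shows nn_integral_complex_iterated: "(\<integral>\<^sup>+z. f z \<partial>lborel) = (\<integral>\<^sup>+x. \<integral>\<^sup>+y. f (Complex x y) \<partial>lborel \<partial>lborel)"
    and nn_integral_complex_iterated': "(\<integral>\<^sup>+z. f z \<partial>lborel) = (\<integral>\<^sup>+y. \<integral>\<^sup>+x. f (Complex x y) \<partial>lborel \<partial>lborel)"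
proof -
  have meas [measurable]: "(\<lambda>(x, y). Complex x y) \<in> borel_measurable (lborel \<Otimes>\<^sub>M lborel)"
    unfolding Complex_eq by measurable
  have f' [measurable]: "(\<lambda>(x, y). f (Complex x y)) \<in> borel_measurable (lborel \<Otimes>\<^sub>M lborel)"
    using measurable_compose[OF meas f] by (simp add: case_prod_beta')
  have "(\<integral>\<^sup>+z. f z \<partial>lborel) = (\<integral>\<^sup>+p. (case p of (x, y) \<Rightarrow> f (Complex x y)) \<partial>(lborel \<Otimes>\<^sub>M lborel))"
    by (subst lborel_complex_eq_distr_pair, subst nn_integral_distr[OF meas])
      (use f in \<open>auto simp: case_prod_beta'\<close>)
  then show "(\<integral>\<^sup>+z. f z \<partial>lborel) = (\<integral>\<^sup>+x. \<integral>\<^sup>+y. f (Complex x y) \<partial>lborel \<partial>lborel)"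
    and "(\<integral>\<^sup>+z. f z \<partial>lborel) = (\<integral>\<^sup>+y. \<integral>\<^sup>+x. f (Complex x y) \<partial>lborel \<partial>lborel)"
    using lborel.nn_integral_fst[OF f'] lborel_pair.nn_integral_snd[OF f'] by simp_all
qed

lemma nn_integral_lborel_translate:
  fixes f :: "real \<Rightarrow> ennreal"
  assumes "f \<in> borel_measurable borel"
  shows "(\<integral>\<^sup>+x. f (x + c) \<partial>lborel) = (\<integral>\<^sup>+x. f x \<partial>lborel)"
  using nn_integral_real_affine[OF assms, of 1 c] by (simp add: add.commute)

lemma
  fixes f :: "complex \<Rightarrow> ennreal"
  assumes f [measurable]: "f \<in> borel_measurable borel"
  shows nn_integral_shear_Re: "(\<integral>\<^sup>+z. f (Complex (Re z + t * Im z) (Im z)) \<partial>lborel) = (\<integral>\<^sup>+z. f z \<partial>lborel)"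
    and nn_integral_shear_Im: "(\<integral>\<^sup>+z. f (Complex (Re z) (Im z + t * Re z)) \<partial>lborel) = (\<integral>\<^sup>+z. f z \<partial>lborel)"
proof -
  have [measurable]: "(\<lambda>z. Complex (Re z + t * Im z) (Im z)) \<in> borel_measurable borel"
    "(\<lambda>z. Complex (Re z) (Im z + t * Re z)) \<in> borel_measurable borel"
    "(\<lambda>x. Complex x y) \<in> borel_measurable borel" "(\<lambda>x. Complex y x) \<in> borel_measurable borel" for y
    unfolding Complex_eq by measurable
  show "(\<integral>\<^sup>+z. f (Complex (Re z + t * Im z) (Im z)) \<partial>lborel) = (\<integral>\<^sup>+z. f z \<partial>lborel)"
    using nn_integral_lborel_translate[of "\<lambda>x. f (Complex x y)" "t * y" for y]
    by (simp add: nn_integral_complex_iterated'[of f]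
        nn_integral_complex_iterated'[of "\<lambda>z. f (Complex (Re z + t * Im z) (Im z))"])
  show "(\<integral>\<^sup>+z. f (Complex (Re z) (Im z + t * Re z)) \<partial>lborel) = (\<integral>\<^sup>+z. f z \<partial>lborel)"
    using nn_integral_lborel_translate[of "\<lambda>x. f (Complex y x)" "t * y" for y]
    by (simp add: nn_integral_complex_iterated[of f]
        nn_integral_complex_iterated[of "\<lambda>z. f (Complex (Re z) (Im z + t * Re z))"])
qed

text \<open>
  A rotation other than the one by \<open>\<pi>\<close> is a composition of three shears, along the real, the
  imaginary and again the real axis, and shears preserve Lebesgue measure by Fubini's theorem and
  translation invariance.
\<close>

lemma lborel_distr_rotation:
  fixes u :: complex
  assumes u: "cmod u = 1" "u \<noteq> -1"
  shows "distr lborel borel ((*) u) = (lborel :: complex measure)"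
proof (rule measure_eqI)
  fix A :: "complex set" assume "A \<in> sets (distr lborel borel ((*) u))"
  then have [measurable]: "A \<in> sets borel" by simp
  let ?f = "indicator A :: complex \<Rightarrow> ennreal"
  \<comment> \<open>\<open>t\<close> is the tangent of half the angle of rotation.\<close>
  define c s t where "c = Re u" and "s = Im u" and "t = s / (1 + c)"
  have cs: "c\<^sup>2 + s\<^sup>2 = 1" using u(1) by (simp add: c_def s_def cmod_def)
  have "1 + c \<noteq> 0"
  proof
    assume "1 + c = 0"
    then have "c = -1" by simp
    then have "s = 0" using cs by simp
    then show False using \<open>c = -1\<close> u(2) by (simp add: c_def s_def complex_eq_iff)
  qed
  then have t1: "t * (1 + c) = s" and "t * s * (1 + c) = s\<^sup>2" by (simp_all add: t_def power2_eq_square)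
  moreover have "s\<^sup>2 = (1 - c) * (1 + c)" using cs by (simp add: power2_eq_square algebra_simps)
  ultimately have t2: "t * s = 1 - c" using \<open>1 + c \<noteq> 0\<close> by simp
  define R where "R z = Complex (Re z + (-t) * Im z) (Im z)" for z
  define I where "I z = Complex (Re z) (Im z + s * Re z)" for z
  have [measurable]: "R \<in> borel_measurable borel" "I \<in> borel_measurable borel"
    unfolding R_def I_def Complex_eq by measurable
  have decomp: "u * z = R (I (R z))" for z
  proof (rule complex_eqI)
    have "Re (R (I (R z))) = (1 - t * s) * Re z - t * (1 + (1 - t * s)) * Im z"
      by (simp add: R_def I_def algebra_simps)
    also have "\<dots> = c * Re z - s * Im z" using t1 t2 by simp
    finally show "Re (u * z) = Re (R (I (R z)))" by (simp add: c_def s_def)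
    have "Im (R (I (R z))) = s * Re z + (1 - t * s) * Im z"
      by (simp add: R_def I_def algebra_simps)
    also have "\<dots> = s * Re z + c * Im z" using t2 by simp
    finally show "Im (u * z) = Im (R (I (R z)))" by (simp add: c_def s_def)
  qed
  have "emeasure (distr lborel borel ((*) u)) A = (\<integral>\<^sup>+z. ?f z \<partial>distr lborel borel ((*) u))" by simp
  also have "\<dots> = (\<integral>\<^sup>+z. ?f (R (I (R z))) \<partial>lborel)"
    by (subst nn_integral_distr) (simp_all add: decomp[symmetric])
  also have "\<dots> = (\<integral>\<^sup>+z. ?f (R (I z)) \<partial>lborel)"
    by (rule nn_integral_shear_Re[of "\<lambda>z. ?f (R (I z))" "-t", folded R_def]) measurable
  also have "\<dots> = (\<integral>\<^sup>+z. ?f (R z) \<partial>lborel)"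
    by (rule nn_integral_shear_Im[of "\<lambda>z. ?f (R z)" s, folded I_def]) measurable
  also have "\<dots> = (\<integral>\<^sup>+z. ?f z \<partial>lborel)"
    by (rule nn_integral_shear_Re[of ?f "-t", folded R_def]) measurable
  also have "\<dots> = emeasure lborel A" by simp
  finally show "emeasure (distr lborel borel ((*) u)) A = emeasure lborel A" .
qed simp

text \<open>
  Rotating by an angle \<open>\<theta>\<close> with \<open>(j - k) \<theta> = \<pi> / 2\<close> multiplies the integrand by the imaginary unit but
  does not change the integral.
\<close>

lemma integral_monomials_orthogonal:
  fixes g :: "real \<Rightarrow> real"
  assumes g: "g \<in> borel_measurable borel" and "j \<noteq> k"
  shows "(\<integral>z. complex_of_real (g (cmod z)) * z ^ j * cnj z ^ k \<partial>lborel) = 0"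
proof -
  define F where "F z = complex_of_real (g (cmod z)) * z ^ j * cnj z ^ k" for z
  define \<theta> where "\<theta> = pi / 2 / (real j - real k)"
  define u where "u = cis \<theta>"
  have "\<bar>\<theta>\<bar> \<le> pi / 2"
  proof -
    have "1 \<le> \<bar>real j - real k\<bar>" using \<open>j \<noteq> k\<close> by linarith
    then have "pi / 2 / \<bar>real j - real k\<bar> \<le> pi / 2 / 1" by (intro divide_left_mono) auto
    moreover have "\<bar>\<theta>\<bar> = pi / 2 / \<bar>real j - real k\<bar>" unfolding \<theta>_def abs_divide by simp
    ultimately show ?thesis by (simp only: div_by_1)
  qed
  then have "0 \<le> cos \<theta>" by (intro cos_ge_zero) auto
  then have "u \<noteq> -1" by (auto simp: u_def complex_eq_iff)
  then have rot: "distr lborel borel ((*) u) = (lborel :: complex measure)"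
    by (intro lborel_distr_rotation) (simp_all add: u_def)
  have "u ^ j * cnj u ^ k = cis ((real j - real k) * \<theta>)"
    unfolding u_def cis_cnj Complex.DeMoivre cis_mult by (simp add: algebra_simps)
  also have "(real j - real k) * \<theta> = pi / 2"
    unfolding \<theta>_def using \<open>j \<noteq> k\<close> by (intro nonzero_mult_div_cancel_left[THEN trans[OF times_divide_eq_right]]) simp
  finally have u: "u ^ j * cnj u ^ k = \<i>" by (simp add: complex_eq_iff)
  have cnj_meas [measurable]: "cnj \<in> borel_measurable borel"
    by (intro borel_measurable_continuous_onI continuous_intros)
  have [measurable]: "F \<in> borel_measurable borel"
    unfolding F_def using g by measurable
  have "(\<integral>z. F z \<partial>lborel) = (\<integral>z. F (u * z) \<partial>lborel)"
    by (subst rot[symmetric], subst integral_distr) auto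
  also have "(\<lambda>z. F (u * z)) = (\<lambda>z. \<i> * F z)"
    unfolding F_def u[symmetric] by (simp add: fun_eq_iff norm_mult u_def power_mult_distrib)
  finally have "(\<integral>z. F z \<partial>lborel) = \<i> * (\<integral>z. F z \<partial>lborel)" by simp
  then have "(1 - \<i>) * (\<integral>z. F z \<partial>lborel) = 0" by (simp add: algebra_simps)
  then have "(\<integral>z. F z \<partial>lborel) = 0" by (simp add: complex_eq_iff)
  then show ?thesis by (simp add: F_def)
qed

text \<open>
  Polar coordinates: the disk \<open>cmod z powr \<alpha> \<le> t\<close> has area \<open>\<pi> t powr (2 / \<alpha>)\<close> for \<open>t \<ge> 0\<close>.
\<close>

lemma distr_cmod_powr:
  fixes \<alpha> :: real
  assumes \<alpha>: "\<alpha> > 0"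
  shows "distr lborel borel (\<lambda>z. cmod z powr \<alpha>) =
    density lborel (\<lambda>t. ennreal (indicator {0..} t * (2 * pi / \<alpha> * t powr (2 / \<alpha> - 1))))"
    (is "?M = ?N")
proof (rule measure_eqI_generator_eq[where E = "range atMost" and A = "\<lambda>n::nat. {..real n}" and \<Omega> = UNIV])
  show "Int_stable (range (atMost :: real \<Rightarrow> _))" by (auto simp: Int_stable_def)
  show "sets ?M = sigma_sets UNIV (range atMost)" "sets ?N = sigma_sets UNIV (range atMost)"
    by (simp_all add: borel_eq_atMost)
  have [measurable]: "(\<lambda>z::complex. cmod z powr \<alpha>) \<in> borel_measurable borel" by measurable
  have M: "emeasure ?M {..t} = (if t < 0 then 0 else ennreal (pi * t powr (2 / \<alpha>)))" for t
  proof -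
    have "emeasure ?M {..t} = emeasure lborel {z::complex. cmod z powr \<alpha> \<le> t}"
      by (subst emeasure_distr) (auto intro!: arg_cong[where f = "emeasure lborel"])
    also have "\<dots> = (if t < 0 then 0 else ennreal (pi * t powr (2 / \<alpha>)))"
    proof (cases "t < 0")
      case True
      then have "{z::complex. cmod z powr \<alpha> \<le> t} = {}" by (auto dest: order_trans[OF powr_ge_zero])
      then show ?thesis using True by simp
    next
      case False
      have iff: "cmod z powr \<alpha> \<le> t \<longleftrightarrow> cmod z \<le> t powr (1 / \<alpha>)" for z
      proof
        assume "cmod z powr \<alpha> \<le> t"
        then have "(cmod z powr \<alpha>) powr (1 / \<alpha>) \<le> t powr (1 / \<alpha>)" using \<alpha> by (intro powr_mono2) auto
        then show "cmod z \<le> t powr (1 / \<alpha>)" using \<alpha> by (simp add: powr_powr)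
      next
        assume "cmod z \<le> t powr (1 / \<alpha>)"
        then have "cmod z powr \<alpha> \<le> (t powr (1 / \<alpha>)) powr \<alpha>" using \<alpha> by (intro powr_mono2) auto
        then show "cmod z powr \<alpha> \<le> t" using \<alpha> False by (simp add: powr_powr)
      qed
      have "{z::complex. cmod z powr \<alpha> \<le> t} = cball 0 (t powr (1 / \<alpha>))"
        unfolding iff by (simp add: cball_def)
      moreover have "(t powr (1 / \<alpha>))\<^sup>2 = t powr (2 / \<alpha>)"
        unfolding power2_eq_square powr_add[symmetric] by (simp add: add_divide_distrib[symmetric])
      ultimately show ?thesis using False
        by (simp add: emeasure_cball unit_ball_vol_2 DIM_complex)
    qed
    finally show ?thesis .
  qed
  have N: "emeasure ?N {..t} = (if t < 0 then 0 else ennreal (pi * t powr (2 / \<alpha>)))" for t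
  proof -
    have "emeasure ?N {..t} = (\<integral>\<^sup>+s. ennreal (indicator {0..t} s * (2 * pi / \<alpha> * s powr (2 / \<alpha> - 1))) \<partial>lborel)"
      by (subst emeasure_density) (auto intro!: nn_integral_cong simp: indicator_def)
    also have "\<dots> = (if t < 0 then 0 else ennreal (pi * t powr (2 / \<alpha>)))"
    proof (cases "t < 0")
      case False
      have "((\<lambda>s. 2 * pi / \<alpha> * s powr (2 / \<alpha> - 1)) has_integral
          (2 * pi / \<alpha> * (t powr (2 / \<alpha> - 1 + 1) / (2 / \<alpha> - 1 + 1)))) {0..t}"
        using False \<alpha> by (intro has_integral_mult_right has_integral_powr_from_0) auto
      then show ?thesis using False \<alpha>
        by (subst nn_integral_has_integral_lebesgue) (auto simp: field_simps)
    qed simp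
    finally show ?thesis .
  qed
  show "emeasure ?M X = emeasure ?N X" if "X \<in> range atMost" for X using that M N by auto
  show "emeasure ?M {..real n} \<noteq> \<infinity>" for n by (simp add: M)
  show "(\<Union>n. {..real n}) = UNIV" by (auto intro: real_arch_simple)
qed auto

section \<open>Tails of the gamma distribution\<close>

lemma nn_integral_Gamma_scaled:
  fixes a c :: real
  assumes a: "a > 0" and c: "c > 0"
  shows "(\<integral>\<^sup>+t. ennreal (indicator {0..} t * t powr (a - 1) / exp (c * t)) \<partial>lborel) = ennreal (Gamma a / c powr a)"
    (is "?I = _")
proof -
  let ?f = "\<lambda>t. ennreal (indicator {0..} t * t powr (a - 1) / exp t)"
  have "ennreal (Gamma a) = (\<integral>\<^sup>+t. ?f t \<partial>lborel)" by (rule Gamma_conv_nn_integral_real[OF a])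
  also have "\<dots> = ennreal \<bar>c\<bar> * (\<integral>\<^sup>+t. ?f (0 + c * t) \<partial>lborel)"
    using c by (intro nn_integral_real_affine) auto
  also have "(\<integral>\<^sup>+t. ?f (0 + c * t) \<partial>lborel) =
      (\<integral>\<^sup>+t. ennreal (c powr (a - 1)) * ennreal (indicator {0..} t * t powr (a - 1) / exp (c * t)) \<partial>lborel)"
    using c by (intro nn_integral_cong)
      (auto simp: indicator_def powr_mult zero_le_mult_iff ennreal_mult[symmetric])
  also have "\<dots> = ennreal (c powr (a - 1)) * ?I"
    by (rule nn_integral_cmult) measurable
  also have "ennreal \<bar>c\<bar> * (ennreal (c powr (a - 1)) * ?I) = ennreal (c powr a) * ?I"
    using c by (simp add: mult.assoc[symmetric] ennreal_mult[symmetric] powr_mult_base)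
  finally have "ennreal (1 / c powr a) * ennreal (Gamma a) = ennreal (1 / c powr a) * (ennreal (c powr a) * ?I)"
    by simp
  also have "\<dots> = ?I"
    using c by (simp add: mult.assoc[symmetric] ennreal_mult[symmetric])
  finally show ?thesis using a c by (simp add: ennreal_mult[symmetric] Gamma_real_pos less_imp_le)
qed

text \<open>
  The gamma distribution with shape \<open>a\<close> and rate 1.
\<close>

definition gamma_dist :: "real \<Rightarrow> real measure" where
  "gamma_dist a = density lborel (\<lambda>t. ennreal (indicator {0..} t * t powr (a - 1) / exp t / Gamma a))"

lemma sets_gamma_dist [simp, measurable_cong]: "sets (gamma_dist a) = sets borel"
  and space_gamma_dist [simp]: "space (gamma_dist a) = UNIV"
  by (simp_all add: gamma_dist_def)

lemma emeasure_gamma_dist: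
  assumes a: "a > 0" and S: "S \<in> sets borel"
  shows "emeasure (gamma_dist a) S =
    ennreal (1 / Gamma a) * (\<integral>\<^sup>+t. ennreal (indicator {0..} t * t powr (a - 1) / exp t) * indicator S t \<partial>lborel)"
proof -
  have "Gamma a > 0" using a by (rule Gamma_real_pos)
  then have scale: "ennreal (x / Gamma a) = ennreal (1 / Gamma a) * ennreal x" if "0 \<le> x" for x
    using that by (simp add: ennreal_mult[symmetric])
  have split: "ennreal (indicator {0..} t * t powr (a - 1) / exp t / Gamma a) =
      ennreal (1 / Gamma a) * ennreal (indicator {0..} t * t powr (a - 1) / exp t)" for t
    by (rule scale) simp
  have "emeasure (gamma_dist a) S = (\<integral>\<^sup>+t. ennreal (1 / Gamma a) *
      (ennreal (indicator {0..} t * t powr (a - 1) / exp t) * indicator S t) \<partial>lborel)"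
    unfolding gamma_dist_def split using S
    by (subst emeasure_density) (simp_all add: mult.assoc)
  also have "\<dots> = ennreal (1 / Gamma a) *
      (\<integral>\<^sup>+t. ennreal (indicator {0..} t * t powr (a - 1) / exp t) * indicator S t \<partial>lborel)"
    using S by (intro nn_integral_cmult) auto
  finally show ?thesis .
qed

lemma prob_space_gamma_dist:
  assumes a: "a > 0"
  shows "prob_space (gamma_dist a)"
proof
  have "Gamma a > 0" using a by (rule Gamma_real_pos)
  then show "emeasure (gamma_dist a) (space (gamma_dist a)) = 1"
    by (simp add: emeasure_gamma_dist[OF a] Gamma_conv_nn_integral_real[OF a, symmetric] ennreal_mult[symmetric])
qed

text \<open>
  The probability that a gamma variable of shape \<open>a\<close> is at least \<open>R\<close>.
\<close>

definition gamma_tail :: "real \<Rightarrow> real \<Rightarrow> real" where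
  "gamma_tail a R = measure (gamma_dist a) {R..}"

lemma gamma_tail_le_1: "a > 0 \<Longrightarrow> gamma_tail a R \<le> 1"
  using prob_space.prob_le_1[OF prob_space_gamma_dist] by (simp add: gamma_tail_def)

lemma gamma_tail_nonneg: "0 \<le> gamma_tail a R"
  by (simp add: gamma_tail_def)

lemma one_minus_gamma_tail:
  assumes "a > 0"
  shows "1 - gamma_tail a R = measure (gamma_dist a) {..<R}"
proof -
  have "{..<R} = space (gamma_dist a) - {R..}" by auto
  then show ?thesis
    using prob_space.prob_compl[OF prob_space_gamma_dist[OF assms], of "{R..}"]
    by (simp add: gamma_tail_def)
qed

lemma gamma_tail_antimono:
  assumes "a > 0" "R \<le> R'"
  shows "gamma_tail a R' \<le> gamma_tail a R"
proof -
  interpret prob_space "gamma_dist a" using assms(1) by (rule prob_space_gamma_dist)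
  show ?thesis unfolding gamma_tail_def using assms(2) by (intro finite_measure_mono) auto
qed

text \<open>
  The exponent in Chernoff's bound, \<open>R h(a / R)\<close> with \<open>h(x) = 1 - x + x ln x\<close>.
\<close>

definition gamma_rate :: "real \<Rightarrow> real \<Rightarrow> real" where
  "gamma_rate R a = R - a - a * ln (R / a)"

text \<open>
  The density is compared with that of rate \<open>a / R\<close> instead of 1, for which \<open>R\<close> is the mean. The
  side condition covers half-lines starting at \<open>R\<close>: upwards if \<open>a \<le> R\<close>, downwards if \<open>R \<le> a\<close>.
\<close>

lemma gamma_chernoff:
  assumes a: "a > 0" and R: "R > 0" and S: "S \<in> sets borel"
    and side: "\<And>t. t \<in> S \<Longrightarrow> 0 \<le> (1 - a / R) * (t - R)"
  shows "measure (gamma_dist a) S \<le> exp (- gamma_rate R a)"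
proof -
  interpret prob_space "gamma_dist a" using a by (rule prob_space_gamma_dist)
  let ?c = "a / R"
  have c: "?c > 0" using a R by simp
  have G: "Gamma a > 0" using a by (rule Gamma_real_pos)
  have "(\<integral>\<^sup>+t. ennreal (indicator {0..} t * t powr (a - 1) / exp t) * indicator S t \<partial>lborel) \<le>
      (\<integral>\<^sup>+t. ennreal (exp (a - R)) * ennreal (indicator {0..} t * t powr (a - 1) / exp (?c * t)) \<partial>lborel)"
  proof (rule nn_integral_mono)
    fix t :: real
    show "ennreal (indicator {0..} t * t powr (a - 1) / exp t) * indicator S t \<le>
        ennreal (exp (a - R)) * ennreal (indicator {0..} t * t powr (a - 1) / exp (?c * t))"
    proof (cases "t \<in> S \<and> 0 \<le> t")
      case True
      have "(1 - ?c) * (t - R) = t - R - ?c * t + a" using R by (simp add: field_simps)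
      then have "- t \<le> a - R - ?c * t" using side[of t] True by simp
      then have "exp (- t) \<le> exp (a - R) * exp (- (?c * t))" by (simp add: exp_add[symmetric])
      then have "t powr (a - 1) * exp (- t) \<le> t powr (a - 1) * (exp (a - R) * exp (- (?c * t)))"
        by (intro mult_left_mono) auto
      then show ?thesis using True
        by (simp add: ennreal_mult[symmetric] exp_minus field_simps)
    qed (auto simp: indicator_def)
  qed
  also have "\<dots> = ennreal (exp (a - R)) * ennreal (Gamma a / ?c powr a)"
    by (subst nn_integral_cmult) (use nn_integral_Gamma_scaled[OF a c] in auto)
  finally have "emeasure (gamma_dist a) S \<le>
      ennreal (1 / Gamma a) * (ennreal (exp (a - R)) * ennreal (Gamma a / ?c powr a))"
    unfolding emeasure_gamma_dist[OF a S] by (rule mult_left_mono) simp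
  also have "\<dots> = ennreal (exp (a - R) / ?c powr a)"
    using G by (simp add: ennreal_mult[symmetric])
  also have "exp (a - R) / ?c powr a = exp (- gamma_rate R a)"
    using a R by (simp add: gamma_rate_def powr_def ln_div exp_diff[symmetric] algebra_simps)
  finally show ?thesis by (simp add: emeasure_eq_measure)
qed

lemma gamma_tail_upper:
  assumes "a > 0" "a \<le> R"
  shows "gamma_tail a R \<le> exp (- gamma_rate R a)"
  unfolding gamma_tail_def using assms
  by (intro gamma_chernoff) (auto intro!: mult_nonneg_nonneg)

lemma one_minus_gamma_tail_upper:
  assumes "R > 0" "R \<le> a"
  shows "1 - gamma_tail a R \<le> exp (- gamma_rate R a)"
  using assms by (subst one_minus_gamma_tail)
    (auto intro!: gamma_chernoff mult_nonpos_nonpos)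

text \<open>
  Stirling's bound up to a factor of order \<open>sqrt a\<close> for large \<open>a\<close>. In the integral for
  \<open>Gamma (a + 1)\<close> the factor \<open>exp (- t / (a + 1))\<close> is split off from \<open>exp (- t)\<close>, and the rest is bounded by its
  maximum, attained at \<open>t = a + 1\<close>.
\<close>

lemma Gamma_upper:
  fixes a :: real
  assumes a: "a > 0"
  shows "Gamma a \<le> exp 1 * (1 + 1 / a) * (a powr a * exp (- a))"
proof -
  have "ennreal (Gamma (a + 1)) = (\<integral>\<^sup>+t. ennreal (indicator {0..} t * t powr a / exp t) \<partial>lborel)"
    using Gamma_conv_nn_integral_real[of "a + 1"] a by simp
  also have "\<dots> \<le> (\<integral>\<^sup>+t. ennreal ((a + 1) powr a * exp (- a)) *
      ennreal (indicator {0..} t * t powr (1 - 1) / exp (1 / (a + 1) * t)) \<partial>lborel)"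
  proof (rule nn_integral_mono_AE, rule AE_mp[OF AE_lborel_singleton[of 0]], rule AE_I2, rule impI)
    fix t :: real assume "t \<noteq> 0"
    show "ennreal (indicator {0..} t * t powr a / exp t) \<le> ennreal ((a + 1) powr a * exp (- a)) *
        ennreal (indicator {0..} t * t powr (1 - 1) / exp (1 / (a + 1) * t))"
    proof (cases "t > 0")
      case True
      define y where "y = t / (a + 1)"
      have y: "y > 0" "t = (a + 1) * y" using True a by (auto simp: y_def)
      have "y \<le> exp (y - 1)" using exp_ge_add_one_self[of "y - 1"] by simp
      then have "y powr a \<le> exp (y - 1) powr a" using y a by (intro powr_mono2) auto
      also have "\<dots> = exp (a * y - a)" by (simp add: exp_powr_real algebra_simps)
      finally have "(a + 1) powr a * y powr a \<le> (a + 1) powr a * exp (a * y - a)"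
        by (intro mult_left_mono) auto
      moreover have "t powr a = (a + 1) powr a * y powr a" using y a by (simp add: powr_mult)
      moreover have "exp (a * y - a) = exp (- a) * exp (t - 1 / (a + 1) * t)"
      proof -
        have "1 / (a + 1) * t = y" by (simp add: y_def)
        then have "- a + (t - 1 / (a + 1) * t) = a * y - a" using y by (simp add: algebra_simps)
        then show ?thesis by (simp only: exp_add[symmetric])
      qed
      ultimately have "t powr a \<le> (a + 1) powr a * exp (- a) * exp (t - 1 / (a + 1) * t)" by simp
      then have "t powr a / exp t \<le> (a + 1) powr a * exp (- a) * exp (t - 1 / (a + 1) * t) / exp t"
        by (intro divide_right_mono) auto
      also have "\<dots> = (a + 1) powr a * exp (- a) * (1 / exp (1 / (a + 1) * t))"
        by (simp add: exp_diff)
      finally show ?thesis using True by (simp add: ennreal_mult[symmetric])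
    qed (use \<open>t \<noteq> 0\<close> in auto)
  qed
  also have "\<dots> = ennreal ((a + 1) powr a * exp (- a)) * ennreal (a + 1)"
    by (subst nn_integral_cmult) (use nn_integral_Gamma_scaled[of 1 "1 / (a + 1)"] a in auto)
  also have "\<dots> = ennreal ((a + 1) powr a * exp (- a) * (a + 1))"
    using a by (intro ennreal_mult[symmetric]) auto
  finally have "Gamma (a + 1) \<le> (a + 1) powr a * exp (- a) * (a + 1)"
    using a by (subst (asm) ennreal_le_iff) auto
  also have "(a + 1) powr a \<le> exp 1 * a powr a"
  proof -
    have "(1 + 1 / a) powr a \<le> exp (1 / a) powr a"
      using a exp_ge_add_one_self[of "1 / a"] by (intro powr_mono2) auto
    then have "(1 + 1 / a) powr a * a powr a \<le> exp 1 * a powr a"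
      using a by (intro mult_right_mono) (auto simp: exp_powr_real)
    moreover have "(1 + 1 / a) powr a * a powr a = (a + 1) powr a"
    proof -
      have "(1 + 1 / a) * a = a + 1" using a by (simp add: field_simps)
      then show ?thesis using a powr_mult[of "1 + 1 / a" a a] by simp
    qed
    ultimately show ?thesis by simp
  qed
  finally have "Gamma (a + 1) \<le> exp 1 * a powr a * exp (- a) * (a + 1)"
    using a by (simp add: mult_right_mono)
  moreover have "Gamma (a + 1) = a * Gamma a" using a by (intro Gamma_plus1) auto
  ultimately show ?thesis using a by (simp add: field_simps)
qed

text \<open>
  Only the part of the integral over \<open>{R..R + 1}\<close> is kept.
\<close>

lemma gamma_tail_lower_Gamma:
  assumes a: "a > 0" and R: "R > 0"
  shows "R powr a / ((R + 1) * exp (R + 1)) / Gamma a \<le> gamma_tail a R"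
    (is "?m / _ \<le> _")
proof -
  interpret prob_space "gamma_dist a" using a by (rule prob_space_gamma_dist)
  have G: "Gamma a > 0" using a by (rule Gamma_real_pos)
  have "ennreal ?m = (\<integral>\<^sup>+t. ennreal ?m * indicator {R..R + 1} t \<partial>lborel)"
    by (simp add: nn_integral_cmult)
  also have "\<dots> \<le> (\<integral>\<^sup>+t. ennreal (indicator {0..} t * t powr (a - 1) / exp t) * indicator {R..} t \<partial>lborel)"
  proof (rule nn_integral_mono)
    fix t :: real
    show "ennreal ?m * indicator {R..R + 1} t \<le>
        ennreal (indicator {0..} t * t powr (a - 1) / exp t) * indicator {R..} t"
    proof (cases "t \<in> {R..R + 1}")
      case True
      have "R powr a / ((R + 1) * exp (R + 1)) \<le> t powr a / (t * exp t)"
        using True R a by (intro frac_le mult_mono powr_mono2) auto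
      also have "\<dots> = t powr (a - 1) / exp t" using True R by (simp add: powr_diff)
      finally show ?thesis using True R by (simp add: ennreal_leI)
    qed simp
  qed
  finally have le: "ennreal (1 / Gamma a) * ennreal ?m \<le> emeasure (gamma_dist a) {R..}"
    by (subst emeasure_gamma_dist[OF a]) (auto intro: mult_left_mono)
  have "ennreal (1 / Gamma a * ?m) = ennreal (1 / Gamma a) * ennreal ?m"
    using G R by (intro ennreal_mult) auto
  with le have "ennreal (1 / Gamma a * ?m) \<le> ennreal (measure (gamma_dist a) {R..})"
    by (simp only: emeasure_eq_measure)
  then have "1 / Gamma a * ?m \<le> measure (gamma_dist a) {R..}"
    by (subst (asm) ennreal_le_iff) auto
  then show ?thesis by (simp add: gamma_tail_def mult_ac)
qed

text \<open>
  Chernoff's bound is sharp up to a factor that is polynomial in \<open>R\<close>.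
\<close>

lemma gamma_tail_lower:
  assumes a: "a > 0" and R: "R > 0"
  shows "exp (- gamma_rate R a) * (exp (- 2) / ((R + 1) * (1 + 1 / a))) \<le> gamma_tail a R"
proof -
  have G: "Gamma a > 0" using a by (rule Gamma_real_pos)
  let ?m = "R powr a / ((R + 1) * exp (R + 1))"
  have "exp (- gamma_rate R a) = R powr a * exp (- R) / (a powr a * exp (- a))"
    using a R by (simp add: gamma_rate_def powr_def ln_div exp_diff[symmetric] exp_add[symmetric] algebra_simps)
  then have "exp (- gamma_rate R a) * (exp (- 2) / ((R + 1) * (1 + 1 / a))) =
      R powr a * (exp (- R) * exp (- 2)) / (a powr a * exp (- a) * ((R + 1) * (1 + 1 / a)))"
    by simp
  also have "exp (- R) * exp (- 2) = 1 / (exp (R + 1) * exp 1)"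
    by (simp add: exp_minus' flip: exp_add)
  also have "R powr a * (1 / (exp (R + 1) * exp 1)) / (a powr a * exp (- a) * ((R + 1) * (1 + 1 / a))) =
      ?m / (exp 1 * (1 + 1 / a) * (a powr a * exp (- a)))"
    by (simp add: mult_ac)
  also have "\<dots> \<le> ?m / Gamma a"
    using G R Gamma_upper[OF a] by (intro divide_left_mono) auto
  finally show ?thesis using gamma_tail_lower_Gamma[OF a R] by simp
qed

section \<open>Asymptotics of the product of gamma tails\<close>

text \<open>
  An antiderivative of \<open>gamma_rate R\<close> on the positive reals; it tends to 0 at 0 and equals \<open>R\<^sup>2 / 4\<close> at \<open>R\<close>.
\<close>

definition gamma_rate_int :: "real \<Rightarrow> real \<Rightarrow> real" where
  "gamma_rate_int R a = R * a - 3 / 4 * a\<^sup>2 - a\<^sup>2 / 2 * ln (R / a)"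

lemma gamma_rate_int_deriv:
  assumes "a > 0" "R > 0"
  shows "(gamma_rate_int R has_real_derivative gamma_rate R a) (at a)"
  unfolding gamma_rate_int_def [abs_def] gamma_rate_def using assms
  by (auto intro!: derivative_eq_intros simp: field_simps power2_eq_square)

lemma gamma_rate_antimono:
  assumes "0 < a" "a \<le> b" "b \<le> R"
  shows "gamma_rate R b \<le> gamma_rate R a"
proof (rule DERIV_nonpos_imp_nonincreasing[OF assms(2)])
  fix x assume x: "a \<le> x" "x \<le> b"
  have "(gamma_rate R has_real_derivative - ln (R / x)) (at x)"
    unfolding gamma_rate_def [abs_def] using x assms
    by (auto intro!: derivative_eq_intros simp: field_simps)
  moreover have "- ln (R / x) \<le> 0" using x assms by simp
  ultimately show "\<exists>y. (gamma_rate R has_real_derivative y) (at x) \<and> y \<le> 0" by blast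
qed

lemma gamma_rate_int_diff:
  assumes "0 < a" "a \<le> b" "b \<le> R"
  shows "(b - a) * gamma_rate R b \<le> gamma_rate_int R b - gamma_rate_int R a"
    and "gamma_rate_int R b - gamma_rate_int R a \<le> (b - a) * gamma_rate R a"
proof -
  have "(b - a) * gamma_rate R b \<le> gamma_rate_int R b - gamma_rate_int R a \<and>
    gamma_rate_int R b - gamma_rate_int R a \<le> (b - a) * gamma_rate R a"
  proof (cases "a = b")
    case False
    then have "a < b" using assms by simp
    then obtain x where x: "a < x" "x < b"
      "gamma_rate_int R b - gamma_rate_int R a = (b - a) * gamma_rate R x"
      using MVT2[of a b "gamma_rate_int R" "gamma_rate R"] gamma_rate_int_deriv assms
      by (metis less_le_trans order_less_le_trans)
    moreover have "gamma_rate R b \<le> gamma_rate R x" "gamma_rate R x \<le> gamma_rate R a"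
      using x assms by (auto intro: gamma_rate_antimono)
    ultimately show ?thesis using \<open>a < b\<close> by (auto intro: mult_left_mono)
  qed simp
  then show "(b - a) * gamma_rate R b \<le> gamma_rate_int R b - gamma_rate_int R a"
    and "gamma_rate_int R b - gamma_rate_int R a \<le> (b - a) * gamma_rate R a" by auto
qed

lemma gamma_rate_self: "R > 0 \<Longrightarrow> gamma_rate R R = 0"
  by (simp add: gamma_rate_def)

lemma gamma_rate_int_self: "R > 0 \<Longrightarrow> gamma_rate_int R R = R\<^sup>2 / 4"
  by (simp add: gamma_rate_int_def power2_eq_square)

text \<open>
  Comparison of the Riemann sum of a decreasing function with its integral. The last summand is
  kept on the left as a correction term, which later makes up for the remaining part of \<open>{0..R}\<close>.
\<close>

lemma gamma_rate_riemann_sum: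
  assumes b: "0 < b"
  shows "b * real (Suc m) \<le> R \<Longrightarrow>
    gamma_rate_int R (b * real (Suc m)) - gamma_rate_int R b + b * gamma_rate R (b * real (Suc m))
      \<le> b * (\<Sum>j\<le>m. gamma_rate R (b * real (Suc j))) \<and>
    b * (\<Sum>j\<le>m. gamma_rate R (b * real (Suc j))) \<le> gamma_rate_int R (b * real (Suc m))"
proof (induction m)
  case 0
  then have R: "b \<le> R" by simp
  then have "0 \<le> ln (R / b)" using b by simp
  then have "0 \<le> b\<^sup>2 / 4 + b\<^sup>2 / 2 * ln (R / b)" by simp
  then have "b * gamma_rate R b \<le> gamma_rate_int R b"
    by (simp add: gamma_rate_def gamma_rate_int_def algebra_simps power2_eq_square)
  then show ?case by simp
next
  case (Suc m)
  let ?x = "b * real (Suc m)" and ?y = "b * real (Suc (Suc m))"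
  have xy: "0 < ?x" "?x \<le> ?y" "?y - ?x = b"
  proof -
    show "0 < ?x" by (intro mult_pos_pos b) simp
    show "?y - ?x = b" by (simp add: algebra_simps)
    then show "?x \<le> ?y" using b by linarith
  qed
  have step: "b * (\<Sum>j\<le>Suc m. gamma_rate R (b * real (Suc j))) =
      b * (\<Sum>j\<le>m. gamma_rate R (b * real (Suc j))) + b * gamma_rate R ?y"
    by (simp only: sum.atMost_Suc distrib_left)
  note diff = gamma_rate_int_diff[OF xy(1,2) Suc.prems, unfolded xy(3)]
  show ?case
    using Suc.IH[OF order_trans[OF xy(2) Suc.prems]] diff unfolding step by linarith
qed

lemma gamma_rate_riemann_sum_bounds:
  assumes b: "0 < b" and R: "b \<le> R"
  defines "n \<equiv> nat \<lfloor>R / b\<rfloor>"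
  shows "R\<^sup>2 / 4 - R * b \<le> b * (\<Sum>j<n. gamma_rate R (b * real (Suc j)))"
    and "b * (\<Sum>j<n. gamma_rate R (b * real (Suc j))) \<le> R\<^sup>2 / 4"
proof -
  have "1 \<le> R / b" using b R by (simp add: field_simps)
  then have "1 \<le> n" unfolding n_def by linarith
  then obtain m where m: "n = Suc m" by (cases n) auto
  have fl: "real n \<le> R / b" "R / b < real n + 1" using \<open>1 \<le> R / b\<close> unfolding n_def by linarith+
  then have x: "b * real n \<le> R" "R - b * real n \<le> b" using b by (auto simp: field_simps)
  have x0: "0 < b * real n" using b m by simp
  have Rpos: "R > 0" using b R by simp
  have sum: "gamma_rate_int R (b * real n) - gamma_rate_int R b + b * gamma_rate R (b * real n)
      \<le> b * (\<Sum>j<n. gamma_rate R (b * real (Suc j))) \<and>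
    b * (\<Sum>j<n. gamma_rate R (b * real (Suc j))) \<le> gamma_rate_int R (b * real n)"
    using gamma_rate_riemann_sum[OF b, of m R] x(1) by (simp only: m lessThan_Suc_atMost)
  note diff = gamma_rate_int_diff[OF x0 x(1) order_refl]
  have nonneg: "0 \<le> gamma_rate R (b * real n)"
    using gamma_rate_antimono[OF x0 x(1) order_refl] gamma_rate_self[OF Rpos] by simp
  have "gamma_rate_int R (b * real n) \<le> R\<^sup>2 / 4"
    using diff(1) by (simp add: gamma_rate_self[OF Rpos] gamma_rate_int_self[OF Rpos])
  then show "b * (\<Sum>j<n. gamma_rate R (b * real (Suc j))) \<le> R\<^sup>2 / 4" using sum by simp
  \<comment> \<open>The interval from \<open>b * real n\<close> to \<open>R\<close> is shorter than one step.\<close>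
  have "(R - b * real n) * gamma_rate R (b * real n) \<le> b * gamma_rate R (b * real n)"
    using x(2) nonneg by (intro mult_right_mono)
  then have "R\<^sup>2 / 4 \<le> gamma_rate_int R (b * real n) + b * gamma_rate R (b * real n)"
    using diff(2) by (simp add: gamma_rate_int_self[OF Rpos])
  moreover have "gamma_rate_int R b \<le> R * b"
  proof -
    have "0 \<le> ln (R / b)" using b R by simp
    then have "0 \<le> 3 / 4 * b\<^sup>2 + b\<^sup>2 / 2 * ln (R / b)" by simp
    then show ?thesis by (simp add: gamma_rate_int_def)
  qed
  ultimately show "R\<^sup>2 / 4 - R * b \<le> b * (\<Sum>j<n. gamma_rate R (b * real (Suc j)))" using sum by linarith
qed

text \<open>
  The constant 9 serves because \<open>exp 2 \<le> 9\<close>.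
\<close>

lemma gamma_tail_far:
  assumes R: "R > 0" and a: "9 * R \<le> a"
  shows "1 - gamma_tail a R \<le> exp (- a)"
proof -
  have "exp 2 = exp 1 * exp (1::real)" by (simp flip: exp_add)
  also have "\<dots> \<le> 3 * 3" by (intro mult_mono exp_le) auto
  also have "3 * 3 \<le> a / R" using a R by (simp add: field_simps)
  finally have "exp 2 \<le> a / R" .
  then have "2 \<le> ln (a / R)" using a R by (subst ln_ge_iff) auto
  then have "a * 2 \<le> a * ln (a / R)" using a R by (intro mult_left_mono) auto
  moreover have "ln (R / a) = - ln (a / R)" using a R by (simp add: ln_div)
  ultimately have "- gamma_rate R a \<le> - a" using R by (simp add: gamma_rate_def)
  then show ?thesis using one_minus_gamma_tail_upper[of R a] R a
    by (smt (verit) exp_le_cancel_iff)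
qed

lemma gamma_tail_product_upper:
  assumes b: "0 < b" and R: "b \<le> R"
    and p: "(\<lambda>J. \<Prod>j<J. gamma_tail (b * real (Suc j)) R) \<longlonglongrightarrow> p"
  shows "p \<le> exp (- (R\<^sup>2 / 4 - R * b) / b)"
proof -
  let ?n = "nat \<lfloor>R / b\<rfloor>" and ?g = "\<lambda>j. gamma_tail (b * real (Suc j)) R"
  have pos: "0 < b * real (Suc j)" for j using b by simp
  note [simp del] = of_nat_Suc
  have small: "b * real (Suc j) \<le> R" if "j < ?n" for j
  proof -
    have "real (Suc j) \<le> R / b" using that by linarith
    then show ?thesis using b by (simp add: field_simps)
  qed
  have "(\<Prod>j<J. ?g j) \<le> exp (- (R\<^sup>2 / 4 - R * b) / b)" if "?n \<le> J" for J
  proof -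
    have "(\<Prod>j<J. ?g j) = (\<Prod>j<?n. ?g j) * (\<Prod>j=?n..<J. ?g j)"
      using that by (simp add: lessThan_atLeast0 prod.atLeastLessThan_concat)
    also have "\<dots> \<le> (\<Prod>j<?n. ?g j) * 1"
      by (intro mult_left_mono prod_le_1 prod_nonneg) (auto simp: gamma_tail_nonneg intro!: gamma_tail_le_1 pos)
    also have "(\<Prod>j<?n. ?g j) \<le> (\<Prod>j<?n. exp (- gamma_rate R (b * real (Suc j))))"
      using small by (intro prod_mono) (auto simp: gamma_tail_nonneg intro!: gamma_tail_upper pos)
    also have "\<dots> = exp (- (\<Sum>j<?n. gamma_rate R (b * real (Suc j))))"
      by (simp add: exp_sum[symmetric] sum_negf)
    also have "\<dots> \<le> exp (- (R\<^sup>2 / 4 - R * b) / b)"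
    proof -
      have "(R\<^sup>2 / 4 - R * b) / b \<le> (\<Sum>j<?n. gamma_rate R (b * real (Suc j)))"
        using gamma_rate_riemann_sum_bounds(1)[OF b R] b by (simp add: field_simps)
      then show ?thesis
        unfolding minus_divide_left[symmetric] exp_le_cancel_iff neg_le_iff_le .
    qed
    finally show ?thesis by simp
  qed
  then show ?thesis by (intro LIMSEQ_le_const2[OF p]) blast
qed

lemma one_minus_sum_le_prod:
  fixes g :: "'a \<Rightarrow> real"
  assumes "finite A" "\<And>x. x \<in> A \<Longrightarrow> 0 \<le> g x \<and> g x \<le> 1"
  shows "1 - (\<Sum>x\<in>A. 1 - g x) \<le> (\<Prod>x\<in>A. g x)"
  using assms
proof (induction A rule: finite_induct)
  case (insert x A)
  have "0 \<le> g x" "g x \<le> 1" and P: "(\<Prod>x\<in>A. g x) \<le> 1"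
    using insert by (auto intro: prod_le_1)
  then have "(1 - g x) * (\<Prod>x\<in>A. g x) \<le> (1 - g x) * 1" by (intro mult_left_mono) auto
  moreover have "1 - (\<Sum>x\<in>A. 1 - g x) \<le> (\<Prod>x\<in>A. g x)" using insert by auto
  ultimately show ?case using insert.hyps by (simp add: algebra_simps)
qed simp

text \<open>
  With \<open>a = b (j + 1)\<close>, there are three ranges of factors. For \<open>a \<le> R\<close> the lower bound
  \<open>gamma_tail_lower\<close> applies, and \<open>w\<close> bounds its prefactor from below. For \<open>a \<ge> R\<close> up to about
  \<open>9 R\<close> the tail at \<open>R\<close> exceeds the tail at \<open>a\<close>, where the exponent vanishes, so that \<open>w\<close> is a lower
  bound. The remaining factors are so close to 1 that their product is at least \<open>1 / 2\<close>.
\<close>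

lemma gamma_tail_product_lower:
  assumes b: "0 < b" and R: "b \<le> R" and far: "exp (- 9 * R) / (1 - exp (- b)) \<le> 1 / 2"
    and p: "(\<lambda>J. \<Prod>j<J. gamma_tail (b * real (Suc j)) R) \<longlonglongrightarrow> p"
  defines "w \<equiv> exp (- 2) / ((9 * R + b + 1) * (1 + 1 / b))"
  shows "exp (- (R\<^sup>2 / (4 * b))) * w powr (9 * R / b + 1) / 2 \<le> p"
proof -
  let ?n = "nat \<lfloor>R / b\<rfloor>" and ?m = "nat \<lceil>9 * R / b\<rceil>" and ?g = "\<lambda>j. gamma_tail (b * real (Suc j)) R"
  let ?h = "\<lambda>j. gamma_rate R (b * real (Suc j))"
  have Rpos: "R > 0" using b R by simp
  have pos: "0 < b * real (Suc j)" for j using b by simp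
  note [simp del] = of_nat_Suc
  have w: "0 < w" "w \<le> 1"
  proof -
    show "0 < w" unfolding w_def using b Rpos
      by (intro divide_pos_pos mult_pos_pos add_pos_pos) auto
    have "1 * 1 \<le> (9 * R + b + 1) * (1 + 1 / b)" using b Rpos by (intro mult_mono) auto
    moreover have "exp (- 2) \<le> (1::real)" by simp
    ultimately have "exp (- 2) / ((9 * R + b + 1) * (1 + 1 / b)) \<le> 1 / 1" by (intro frac_le) auto
    then show "w \<le> 1" by (simp add: w_def)
  qed
  have nm: "?n \<le> ?m"
  proof -
    have "R / b \<le> 9 * R / b" using b Rpos by (simp add: divide_right_mono)
    then show ?thesis by linarith
  qed
  have w_le: "w \<le> exp (- 2) / ((x + 1) * (1 + 1 / a))" if "b \<le> a" "0 < x" "x \<le> 9 * R + b" for a x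
    unfolding w_def using b that by (intro divide_left_mono mult_mono add_mono mult_pos_pos) (auto simp: frac_le add_pos_pos)
  have bulk1: "exp (- ?h j) * w \<le> ?g j" if "j < ?n" for j
  proof -
    have "exp (- ?h j) * w \<le> exp (- ?h j) * (exp (- 2) / ((R + 1) * (1 + 1 / (b * real (Suc j)))))"
      using b Rpos by (intro mult_left_mono w_le) auto
    then show ?thesis using gamma_tail_lower[OF pos Rpos, of j] by simp
  qed
  have bulk2: "w \<le> ?g j" if j: "?n \<le> j" "j < ?m" for j
  proof -
    let ?a = "b * real (Suc j)"
    have "R / b < real (Suc j)" using j(1) by linarith
    then have Ra: "R \<le> ?a" using b by (simp add: field_simps)
    have "real j < 9 * R / b" using j(2) by linarith
    then have a9: "?a \<le> 9 * R + b" using b by (simp add: field_simps of_nat_Suc)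
    have "w \<le> exp (- 2) / ((?a + 1) * (1 + 1 / ?a))"
      using b pos a9 by (intro w_le) auto
    also have "\<dots> \<le> gamma_tail ?a ?a"
      using gamma_tail_lower[OF pos pos, of j j] by (simp add: gamma_rate_self[OF pos])
    also have "\<dots> \<le> ?g j" using Ra by (intro gamma_tail_antimono pos)
    finally show ?thesis .
  qed
  have bulk: "exp (- (R\<^sup>2 / (4 * b))) * w powr (9 * R / b + 1) \<le> (\<Prod>j<?m. ?g j)"
  proof -
    have "exp (- (R\<^sup>2 / (4 * b))) \<le> exp (- (\<Sum>j<?n. ?h j))"
      using gamma_rate_riemann_sum_bounds(2)[OF b R] b by (simp add: field_simps)
    moreover have "w powr (9 * R / b + 1) \<le> w ^ ?m"
    proof -
      have "0 \<le> 9 * R / b" using b Rpos by simp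
      then have "real ?m \<le> 9 * R / b + 1" by linarith
      then have "w powr (9 * R / b + 1) \<le> w powr real ?m"
        using w by (intro powr_mono') auto
      then show ?thesis using w by (simp add: powr_realpow)
    qed
    ultimately have "exp (- (R\<^sup>2 / (4 * b))) * w powr (9 * R / b + 1) \<le> exp (- (\<Sum>j<?n. ?h j)) * w ^ ?m"
      by (intro mult_mono) auto
    also have "\<dots> = (\<Prod>j<?n. exp (- ?h j) * w) * (\<Prod>j=?n..<?m. w)"
      using nm by (simp add: prod.distrib exp_sum[symmetric] sum_negf power_add[symmetric])
    also have "\<dots> \<le> (\<Prod>j<?n. ?g j) * (\<Prod>j=?n..<?m. ?g j)"
      using w bulk1 bulk2 by (intro mult_mono prod_mono prod_nonneg) (auto simp: gamma_tail_nonneg)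
    also have "\<dots> = (\<Prod>j<?m. ?g j)"
      using nm by (simp add: lessThan_atLeast0 prod.atLeastLessThan_concat)
    finally show ?thesis .
  qed
  have tail: "1 / 2 \<le> (\<Prod>j=?m..<J. ?g j)" for J
  proof -
    let ?q = "exp (- b)"
    have q: "0 < ?q" "?q < 1" using b by auto
    have shift: "(\<Sum>j=m..<J. f (j - m)) = (\<Sum>i<J - m. f i)" for m and f :: "nat \<Rightarrow> real"
      by (rule sum.reindex_bij_witness[of _ "\<lambda>i. i + m" "\<lambda>j. j - m"]) auto
    have e: "1 - ?g j \<le> exp (- 9 * R) * ?q ^ (j - ?m)" if "?m \<le> j" for j
    proof -
      have "9 * R / b \<le> real ?m" by linarith
      then have m9: "9 * R \<le> b * real ?m" using b by (simp add: field_simps)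
      have split: "b * real (Suc j) = b * real ?m + b * real (j - ?m) + b"
        using that by (simp add: of_nat_diff of_nat_Suc algebra_simps)
      moreover have "0 \<le> b * real (j - ?m)" using b by simp
      ultimately have "9 * R \<le> b * real (Suc j)" using m9 b by linarith
      then have "1 - ?g j \<le> exp (- (b * real (Suc j)))" by (rule gamma_tail_far[OF Rpos])
      also have "\<dots> \<le> exp (- 9 * R + real (j - ?m) * - b)"
        using m9 split b by (simp add: mult.commute)
      also have "\<dots> = exp (- 9 * R) * ?q ^ (j - ?m)"
        by (simp only: exp_add exp_of_nat_mult)
      finally show ?thesis .
    qed
    have "(\<Sum>j=?m..<J. 1 - ?g j) \<le> (\<Sum>j=?m..<J. exp (- 9 * R) * ?q ^ (j - ?m))"
      using e by (intro sum_mono) auto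
    also have "\<dots> = exp (- 9 * R) * (\<Sum>i<J - ?m. ?q ^ i)"
      by (simp only: sum_distrib_left[symmetric] shift)
    also have "\<dots> \<le> exp (- 9 * R) * (1 / (1 - ?q))"
      using q by (intro mult_left_mono) (auto simp: sum_gp_strict divide_right_mono)
    also have "\<dots> \<le> 1 / 2" using far by simp
    finally have "1 / 2 \<le> 1 - (\<Sum>j=?m..<J. 1 - ?g j)" by simp
    also have "\<dots> \<le> (\<Prod>j=?m..<J. ?g j)"
      by (rule one_minus_sum_le_prod) (auto simp: gamma_tail_nonneg intro!: gamma_tail_le_1 pos)
    finally show ?thesis .
  qed
  have "exp (- (R\<^sup>2 / (4 * b))) * w powr (9 * R / b + 1) / 2 \<le> (\<Prod>j<J. ?g j)" if "?m \<le> J" for J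
  proof -
    have "exp (- (R\<^sup>2 / (4 * b))) * w powr (9 * R / b + 1) * (1 / 2) \<le> (\<Prod>j<?m. ?g j) * (\<Prod>j=?m..<J. ?g j)"
      by (intro mult_mono bulk tail prod_nonneg) (auto simp: gamma_tail_nonneg)
    also have "\<dots> = (\<Prod>j<J. ?g j)"
      using that by (simp add: lessThan_atLeast0 prod.atLeastLessThan_concat)
    finally show ?thesis by simp
  qed
  then show ?thesis by (intro LIMSEQ_le_const[OF p]) blast
qed

theorem gamma_tail_product_asymptotics:
  fixes p :: "real \<Rightarrow> real"
  assumes b: "b > 0"
    and p: "\<And>R. R > 0 \<Longrightarrow> (\<lambda>J. \<Prod>j<J. gamma_tail (b * real (Suc j)) R) \<longlonglongrightarrow> p R"
  shows "((\<lambda>R. ln (p R) / R\<^sup>2) \<longlongrightarrow> - 1 / (4 * b)) at_top"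
proof (rule tendsto_sandwich)
  define w where "w R = exp (- 2) / ((9 * R + b + 1) * (1 + 1 / b))" for R
  let ?low = "\<lambda>R. (- (R\<^sup>2 / (4 * b)) + (9 * R / b + 1) * ln (w R) - ln 2) / R\<^sup>2"
  let ?up = "\<lambda>R. (- (R\<^sup>2 / 4 - R * b) / b) / R\<^sup>2"
  have limit: "- 1 / (4 * b) = - (inverse b / 4)" by (simp add: inverse_eq_divide)
  \<comment> \<open>The name makes the sign of this constant available to \<open>real_asymp\<close>.\<close>
  define c where "c = 1 + 1 / b"
  have "0 < c" using b by (simp add: c_def add_pos_pos)
  then show "(?low \<longlongrightarrow> - 1 / (4 * b)) at_top"
    unfolding limit w_def c_def[symmetric] using b by real_asymp
  show "(?up \<longlongrightarrow> - 1 / (4 * b)) at_top" unfolding limit using b by real_asymp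
  have "((\<lambda>R. exp (- 9 * R) / (1 - exp (- b))) \<longlongrightarrow> 0) at_top" using b by real_asymp
  then have "\<forall>\<^sub>F R in at_top. exp (- 9 * R) / (1 - exp (- b)) < 1 / 2"
    by (rule order_tendstoD) simp
  then have "\<forall>\<^sub>F R in at_top. b \<le> R \<and> exp (- 9 * R) / (1 - exp (- b)) \<le> 1 / 2"
    using eventually_ge_at_top[of b] by eventually_elim simp
  then have bounds: "\<forall>\<^sub>F R in at_top. 0 < R \<and> ?low R \<le> ln (p R) / R\<^sup>2 \<and> ln (p R) / R\<^sup>2 \<le> ?up R"
  proof eventually_elim
    case (elim R)
    then have R: "b \<le> R" "0 < R" using b by auto
    note lower = gamma_tail_product_lower[OF b R(1) conjunct2[OF elim] p[OF R(2)], folded w_def]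
    note upper = gamma_tail_product_upper[OF b R(1) p[OF R(2)]]
    have w: "0 < w R" unfolding w_def using b R
      by (intro divide_pos_pos mult_pos_pos add_pos_pos) auto
    have pos: "0 < exp (- (R\<^sup>2 / (4 * b))) * w R powr (9 * R / b + 1) / 2" using w by simp
    then have "0 < p R" using lower by simp
    have "ln (exp (- (R\<^sup>2 / (4 * b))) * w R powr (9 * R / b + 1) / 2) \<le> ln (p R)"
      using lower pos by (subst ln_le_cancel_iff) (use \<open>0 < p R\<close> in auto)
    also have "ln (exp (- (R\<^sup>2 / (4 * b))) * w R powr (9 * R / b + 1) / 2) =
        - (R\<^sup>2 / (4 * b)) + (9 * R / b + 1) * ln (w R) - ln 2"
      using w by (simp add: ln_div ln_mult ln_powr)
    finally have "?low R \<le> ln (p R) / R\<^sup>2" by (intro divide_right_mono) auto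
    moreover have "ln (p R) \<le> ln (exp (- (R\<^sup>2 / 4 - R * b) / b))"
      using upper \<open>0 < p R\<close> by (subst ln_le_cancel_iff) auto
    then have "ln (p R) / R\<^sup>2 \<le> ?up R" unfolding ln_exp by (intro divide_right_mono) auto
    ultimately show ?case using R by blast
  qed
  then show "\<forall>\<^sub>F R in at_top. ?low R \<le> ln (p R) / R\<^sup>2" by (rule eventually_mono) blast
  from bounds show "\<forall>\<^sub>F R in at_top. ln (p R) / R\<^sup>2 \<le> ?up R" by (rule eventually_mono) blast
qed

section \<open>The Mittag-Leffler process\<close>

lemma image_scale_ball:
  assumes "r > 0"
  shows "(\<lambda>z. complex_of_real r * z) ` ball 0 1 = ball 0 r"
proof (intro equalityI subsetI)
  fix z :: complex assume "z \<in> ball 0 r"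
  then have "z / complex_of_real r \<in> ball 0 1" using assms by (simp add: norm_divide)
  moreover have "z = complex_of_real r * (z / complex_of_real r)" using assms by simp
  ultimately show "z \<in> (\<lambda>z. complex_of_real r * z) ` ball 0 1" by blast
qed (use assms in \<open>auto simp: norm_mult\<close>)

text \<open>
  By \<open>gamma_tail_lower_Gamma\<close>, \<open>Gamma a\<close> is at least a constant multiple of \<open>T powr a\<close> for every
  \<open>T > 0\<close>; the choice \<open>T powr b = 2 x\<close> gives a geometric majorant.
\<close>

lemma summable_power_over_Gamma:
  fixes b x :: real
  assumes b: "b > 0" and x: "x > 0"
  shows "summable (\<lambda>j. x ^ j / Gamma (b * real (Suc j)))"
proof -
  define T where "T = (2 * x) powr (1 / b)"
  define C where "C = (T + 1) * exp (T + 1) / (2 * x)"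
  have T: "T > 0" using x by (simp add: T_def)
  have bound: "x ^ j / Gamma (b * real (Suc j)) \<le> C * (1 / 2) ^ j" for j
  proof -
    let ?a = "b * real (Suc j)"
    have a: "?a > 0" using b by simp
    have G: "Gamma ?a > 0" using a by (rule Gamma_real_pos)
    have "T powr ?a = (2 * x) ^ Suc j"
      using x b unfolding T_def powr_powr by (subst powr_realpow[symmetric]) auto
    moreover have "T powr ?a / ((T + 1) * exp (T + 1)) / Gamma ?a \<le> 1"
      using gamma_tail_lower_Gamma[OF a T] gamma_tail_le_1[OF a, of T] by linarith
    ultimately have "(2 * x) ^ Suc j / Gamma ?a / ((T + 1) * exp (T + 1)) \<le> 1"
      by (simp only: divide_divide_eq_left mult.commute[of "Gamma ?a"])
    moreover have "0 < (T + 1) * exp (T + 1)" using T by simp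
    ultimately have "(2 * x) ^ Suc j / Gamma ?a \<le> (T + 1) * exp (T + 1)"
      by (simp only: pos_divide_le_eq mult_1_left)
    then have le: "(2 * x) ^ Suc j / Gamma ?a * ((1 / 2) ^ j / (2 * x)) \<le> (T + 1) * exp (T + 1) * ((1 / 2) ^ j / (2 * x))"
      using x by (intro mult_right_mono) auto
    have "(2 * x) ^ j * (1 / 2) ^ j = x ^ j" by (simp only: power_mult_distrib[symmetric]) simp
    then have "x ^ j / Gamma ?a = (2 * x) ^ Suc j / Gamma ?a * ((1 / 2) ^ j / (2 * x))"
      using x by simp
    also note le
    also have "(T + 1) * exp (T + 1) * ((1 / 2) ^ j / (2 * x)) = C * (1 / 2) ^ j" by (simp add: C_def)
    finally show ?thesis .
  qed
  show ?thesis
  proof (rule summable_comparison_test')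
    show "summable (\<lambda>j. C * (1 / 2 :: real) ^ j)" by (intro summable_mult summable_geometric) simp
    show "norm (x ^ j / Gamma (b * real (Suc j))) \<le> C * (1 / 2) ^ j" if "j \<ge> 0" for j
    proof -
      have "0 < Gamma (b * real (Suc j))" using b by (intro Gamma_real_pos mult_pos_pos) auto
      then have "0 \<le> x ^ j / Gamma (b * real (Suc j))" using x by (intro divide_nonneg_pos) auto
      then show ?thesis using bound[of j] unfolding real_norm_def by linarith
    qed
  qed
qed

text \<open>
  The coefficient of \<open>(z * cnj w) ^ j\<close> in the Mittag-Leffler kernel, apart from the exponential weight.
\<close>

definition ml_coeff :: "real \<Rightarrow> nat \<Rightarrow> real" where
  "ml_coeff \<alpha> j = \<alpha> / (2 * pi) / Gamma (2 / \<alpha> * real (Suc j))"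

text \<open>
  The weighted monomials, cut off to the disk of radius \<open>r\<close>, that expand the Mittag-Leffler kernel.
\<close>

definition ml_basis :: "real \<Rightarrow> real \<Rightarrow> nat \<Rightarrow> complex \<Rightarrow> complex" where
  "ml_basis \<alpha> r j z = complex_of_real (indicator {..<r} (cmod z) * sqrt (ml_coeff \<alpha> j) * exp (- (cmod z powr \<alpha>) / 2)) * z ^ j"

lemma ml_coeff_pos: "\<alpha> > 0 \<Longrightarrow> ml_coeff \<alpha> j > 0"
  by (simp add: ml_coeff_def Gamma_real_pos del: of_nat_Suc)

lemma radial_integral:
  fixes f :: "real \<Rightarrow> ennreal"
  assumes \<alpha>: "\<alpha> > 0" and f: "f \<in> borel_measurable borel"
  shows "(\<integral>\<^sup>+z. f (cmod z powr \<alpha>) \<partial>lborel) =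
    (\<integral>\<^sup>+t. ennreal (indicator {0..} t * (2 * pi / \<alpha> * t powr (2 / \<alpha> - 1))) * f t \<partial>lborel)"
proof -
  have "(\<integral>\<^sup>+z. f (cmod z powr \<alpha>) \<partial>lborel) = (\<integral>\<^sup>+t. f t \<partial>distr lborel borel (\<lambda>z::complex. cmod z powr \<alpha>))"
    using f by (subst nn_integral_distr) auto
  also have "\<dots> = (\<integral>\<^sup>+t. ennreal (indicator {0..} t * (2 * pi / \<alpha> * t powr (2 / \<alpha> - 1))) * f t \<partial>lborel)"
    unfolding distr_cmod_powr[OF \<alpha>] using f by (subst nn_integral_density) auto
  finally show ?thesis .
qed

lemma ml_basis_norm_integral:
  assumes \<alpha>: "\<alpha> > 0" and r: "r > 0"
  shows "(\<integral>z. (cmod (ml_basis \<alpha> r j z))\<^sup>2 \<partial>lborel) = 1 - gamma_tail (2 / \<alpha> * real (Suc j)) (r powr \<alpha>)"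
proof -
  define b a R where "b = 2 / \<alpha>" and "a = b * real (Suc j)" and "R = r powr \<alpha>"
  have a: "a > 0" using \<alpha> by (simp add: a_def b_def)
  have G: "Gamma a > 0" using a by (rule Gamma_real_pos)
  interpret prob_space "gamma_dist a" using a by (rule prob_space_gamma_dist)
  define f where "f t = ennreal (ml_coeff \<alpha> j * (t powr (b * real j) / exp t)) * indicator {..<R} t" for t
  have [measurable]: "f \<in> borel_measurable borel" unfolding f_def by measurable
  have [measurable]: "ml_basis \<alpha> r j \<in> borel_measurable borel"
    unfolding ml_basis_def [abs_def] by measurable
  have "(\<integral>\<^sup>+z. ennreal ((cmod (ml_basis \<alpha> r j z))\<^sup>2) \<partial>lborel) = (\<integral>\<^sup>+z. f (cmod z powr \<alpha>) \<partial>lborel)"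
  \<comment> \<open>At the origin the two sides differ for \<open>j = 0\<close>, since \<open>0 powr 0 = 0\<close>.\<close>
  proof (rule nn_integral_cong_AE, rule AE_mp[OF AE_lborel_singleton[of 0]], rule AE_I2, rule impI)
    fix z :: complex assume z: "z \<noteq> 0"
    have "cmod z < r \<longleftrightarrow> cmod z powr \<alpha> < R"
      using powr_less_mono2[OF \<alpha>, of "cmod z" r] powr_mono2[of \<alpha> r "cmod z"] r \<alpha>
      unfolding R_def by (meson less_imp_le norm_ge_zero not_less)
    moreover have "(cmod z ^ j)\<^sup>2 = (cmod z powr \<alpha>) powr (b * real j)"
      using z \<alpha> by (simp add: b_def powr_powr power_mult[symmetric] powr_realpow[symmetric] mult.commute)
    moreover have "(exp (- (cmod z powr \<alpha>) / 2))\<^sup>2 = 1 / exp (cmod z powr \<alpha>)"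
    proof -
      have "(exp (- (cmod z powr \<alpha>) / 2))\<^sup>2 = exp (- (cmod z powr \<alpha>))"
        by (simp add: power2_eq_square flip: exp_add)
      then show ?thesis by (simp add: exp_minus inverse_eq_divide)
    qed
    ultimately show "ennreal ((cmod (ml_basis \<alpha> r j z))\<^sup>2) = f (cmod z powr \<alpha>)"
      using ml_coeff_pos[OF \<alpha>, of j]
      by (auto simp: ml_basis_def f_def norm_mult norm_power power_mult_distrib indicator_def)
  qed
  also have "\<dots> = (\<integral>\<^sup>+t. ennreal (1 / Gamma a) * (ennreal (indicator {0..} t * t powr (a - 1) / exp t) * indicator {..<R} t) \<partial>lborel)"
    unfolding radial_integral[OF \<alpha> \<open>f \<in> borel_measurable borel\<close>]
  proof (rule nn_integral_cong)
    fix t :: real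
    have "a - 1 = 2 / \<alpha> - 1 + b * real j"
      by (simp add: a_def b_def algebra_simps add_divide_distrib)
    then have "t powr (a - 1) = t powr (2 / \<alpha> - 1) * t powr (b * real j)"
      by (simp only: powr_add)
    then have "2 * pi / \<alpha> * t powr (2 / \<alpha> - 1) * (ml_coeff \<alpha> j * (t powr (b * real j) / exp t)) =
        1 / Gamma a * (t powr (a - 1) / exp t)"
      using \<alpha> by (simp add: ml_coeff_def a_def b_def del: of_nat_Suc)
    then show "ennreal (indicator {0..} t * (2 * pi / \<alpha> * t powr (2 / \<alpha> - 1))) * f t =
        ennreal (1 / Gamma a) * (ennreal (indicator {0..} t * t powr (a - 1) / exp t) * indicator {..<R} t)"
      using \<alpha> G ml_coeff_pos[OF \<alpha>, of j]
      by (auto simp: f_def indicator_def ennreal_mult[symmetric])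
  qed
  also have "\<dots> = emeasure (gamma_dist a) {..<R}"
    unfolding emeasure_gamma_dist[OF a lessThan_borel] by (rule nn_integral_cmult) measurable
  finally have "(\<integral>\<^sup>+z. ennreal ((cmod (ml_basis \<alpha> r j z))\<^sup>2) \<partial>lborel) = ennreal (1 - gamma_tail a R)"
    by (simp add: one_minus_gamma_tail[OF a] emeasure_eq_measure)
  then show ?thesis
    using gamma_tail_le_1[OF a, of R] by (subst integral_eq_nn_integral) (auto simp: a_def b_def R_def)
qed

lemma ml_basis_orthogonal:
  assumes \<alpha>: "\<alpha> > 0" and "j \<noteq> k"
  shows "(\<integral>z. ml_basis \<alpha> r j z * cnj (ml_basis \<alpha> r k z) \<partial>lborel) = 0"
proof -
  define g where "g s = indicator {..<r} s * sqrt (ml_coeff \<alpha> j) * sqrt (ml_coeff \<alpha> k) * exp (- (s powr \<alpha>))" for s :: real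
  have "g \<in> borel_measurable borel" unfolding g_def [abs_def] by measurable
  then have "(\<integral>z. complex_of_real (g (cmod z)) * z ^ j * cnj z ^ k \<partial>lborel) = 0"
    using \<open>j \<noteq> k\<close> by (rule integral_monomials_orthogonal)
  moreover have "ml_basis \<alpha> r j z * cnj (ml_basis \<alpha> r k z) = complex_of_real (g (cmod z)) * z ^ j * cnj z ^ k" for z
  proof -
    have "exp (- (cmod z powr \<alpha>)) = exp (- (cmod z powr \<alpha>) / 2) * exp (- (cmod z powr \<alpha>) / 2)"
      by (simp flip: exp_add)
    then show ?thesis by (simp add: ml_basis_def g_def indicator_def)
  qed
  ultimately show ?thesis by simp
qed

lemma trace_class_ml_basis:
  assumes \<alpha>: "\<alpha> > 0" and r: "r > 0"
  shows "trace_class_kernel lborel (ml_basis \<alpha> r) (ball 0 r) (\<lambda>j. sqrt (ml_coeff \<alpha> j) * r ^ j)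
    (\<lambda>j. 1 - gamma_tail (2 / \<alpha> * real (Suc j)) (r powr \<alpha>))"
proof (intro trace_class_kernel.intro trace_class_kernel_axioms.intro)
  show "sigma_finite_measure (lborel :: complex measure)" by (rule lborel.sigma_finite_measure_axioms)
  show "ml_basis \<alpha> r j \<in> borel_measurable lborel" for j
    unfolding ml_basis_def [abs_def] by measurable
  show "ball 0 r \<in> sets (lborel :: complex measure)" by simp
  show "emeasure lborel (ball (0::complex) r) < \<infinity>" using emeasure_bounded_finite[of "ball (0::complex) r"] by simp
  show "cmod (ml_basis \<alpha> r j z) \<le> sqrt (ml_coeff \<alpha> j) * r ^ j" if "z \<in> ball 0 r" for j z
  proof -
    have "cmod (ml_basis \<alpha> r j z) = sqrt (ml_coeff \<alpha> j) * (exp (- (cmod z powr \<alpha>) / 2) * cmod z ^ j)"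
      using that ml_coeff_pos[OF \<alpha>, of j] by (simp add: ml_basis_def norm_mult norm_power)
    also have "\<dots> \<le> sqrt (ml_coeff \<alpha> j) * (1 * r ^ j)"
      using that r ml_coeff_pos[OF \<alpha>, of j] by (intro mult_left_mono mult_mono power_mono) auto
    finally show ?thesis by simp
  qed
  show "ml_basis \<alpha> r j z = 0" if "z \<notin> ball 0 r" for j z
    using that by (simp add: ml_basis_def)
  have square: "(sqrt (ml_coeff \<alpha> j) * r ^ j)\<^sup>2 = \<alpha> / (2 * pi) * ((r\<^sup>2) ^ j / Gamma (2 / \<alpha> * real (Suc j)))" for j
    using ml_coeff_pos[OF \<alpha>, of j]
    by (simp add: power_mult_distrib ml_coeff_def power_mult[symmetric] mult.commute del: of_nat_Suc)
  show "summable (\<lambda>j. (sqrt (ml_coeff \<alpha> j) * r ^ j)\<^sup>2)"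
    unfolding square using \<alpha> r by (intro summable_mult summable_power_over_Gamma) auto
  show "(\<integral>z. ml_basis \<alpha> r j z * cnj (ml_basis \<alpha> r k z) \<partial>lborel) =
      (if j = k then complex_of_real (1 - gamma_tail (2 / \<alpha> * real (Suc j)) (r powr \<alpha>)) else 0)" for j k :: nat
  proof (cases "j = k")
    case True
    have "(\<integral>z. ml_basis \<alpha> r j z * cnj (ml_basis \<alpha> r j z) \<partial>lborel) =
        complex_of_real (\<integral>z. (cmod (ml_basis \<alpha> r j z))\<^sup>2 \<partial>lborel)"
      by (simp only: complex_norm_square[symmetric] integral_complex_of_real)
    then show ?thesis
      unfolding ml_basis_norm_integral[OF \<alpha> r] using True by (simp del: of_nat_Suc)
  qed (simp add: ml_basis_orthogonal[OF \<alpha>])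
qed

lemma ml_basis_kernel:
  assumes \<alpha>: "\<alpha> > 0" and r: "r > 0" and zw: "z \<in> ball 0 r" "w \<in> ball 0 r"
  shows "trace_class_kernel.kernel (ml_basis \<alpha> r) z w = mittag_leffler_kernel \<alpha> z w"
proof -
  interpret trace_class_kernel lborel "ml_basis \<alpha> r" "ball 0 r" "\<lambda>j. sqrt (ml_coeff \<alpha> j) * r ^ j"
    "\<lambda>j. 1 - gamma_tail (2 / \<alpha> * real (Suc j)) (r powr \<alpha>)"
    using \<alpha> r by (rule trace_class_ml_basis)
  let ?E = "complex_of_real (exp (- (cmod z powr \<alpha>) / 2 - (cmod w powr \<alpha>) / 2))"
  let ?C = "complex_of_real (\<alpha> / (2 * pi)) * ?E"
  let ?t = "\<lambda>k. (z * cnj w) ^ k / complex_of_real (Gamma (2 / \<alpha> * real k + 2 / \<alpha>))"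
  have term_eq: "ml_basis \<alpha> r k z * cnj (ml_basis \<alpha> r k w) = ?C * ?t k" for k
  proof -
    have "2 / \<alpha> * real (Suc k) = 2 / \<alpha> * real k + 2 / \<alpha>" by (simp add: distrib_left add_divide_distrib)
    moreover have "sqrt (ml_coeff \<alpha> k) * sqrt (ml_coeff \<alpha> k) = ml_coeff \<alpha> k"
      using ml_coeff_pos[OF \<alpha>, of k] by simp
    ultimately have "sqrt (ml_coeff \<alpha> k) * sqrt (ml_coeff \<alpha> k) = \<alpha> / (2 * pi) / Gamma (2 / \<alpha> * real k + 2 / \<alpha>)"
      by (simp only: ml_coeff_def)
    then have s: "complex_of_real (sqrt (ml_coeff \<alpha> k)) * complex_of_real (sqrt (ml_coeff \<alpha> k)) =
        complex_of_real (\<alpha> / (2 * pi)) / complex_of_real (Gamma (2 / \<alpha> * real k + 2 / \<alpha>))"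
      by (simp only: of_real_mult[symmetric] of_real_divide[symmetric])
    have e: "?E = complex_of_real (exp (- (cmod z powr \<alpha>) / 2)) * complex_of_real (exp (- (cmod w powr \<alpha>) / 2))"
      by (simp only: of_real_mult[symmetric] exp_add[symmetric]) simp
    have "ml_basis \<alpha> r k z * cnj (ml_basis \<alpha> r k w) =
        (complex_of_real (sqrt (ml_coeff \<alpha> k)) * complex_of_real (sqrt (ml_coeff \<alpha> k))) *
        (complex_of_real (exp (- (cmod z powr \<alpha>) / 2)) * complex_of_real (exp (- (cmod w powr \<alpha>) / 2))) *
        (z * cnj w) ^ k"
      using zw by (simp add: ml_basis_def power_mult_distrib mult_ac)
    then show ?thesis unfolding s e[symmetric] by (simp add: mult_ac)
  qed
  have "?C \<noteq> 0" using \<alpha> by simp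
  moreover have "summable (\<lambda>k. ?C * ?t k)" using kernel_summable[of z w] by (simp only: term_eq)
  ultimately have "summable ?t" by (simp only: summable_cmult_iff simp_thms)
  then have "(\<Sum>k. ?C * ?t k) = ?C * (\<Sum>k. ?t k)" by (rule suminf_mult)
  then show ?thesis
    unfolding kernel_def term_eq mittag_leffler_kernel_def mittag_leffler_def by (simp add: mult_ac)
qed

text \<open>
  The hole probability equals the probability that independent gamma variables of shapes
  \<open>2 j / \<alpha>\<close>, \<open>j \<ge> 1\<close>, are all at least \<open>r powr \<alpha>\<close>.
\<close>

theorem hole_probability_product:
  fixes \<alpha> :: real and M :: "'w measure" and X :: "'w \<Rightarrow> complex set"
  assumes \<alpha>: "\<alpha> > 0" and r: "r > 0"
    and X: "determinantal_point_process M X lborel (mittag_leffler_kernel \<alpha>)"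
  shows "(\<lambda>J. \<Prod>j<J. gamma_tail (2 / \<alpha> * real (Suc j)) (r powr \<alpha>))
    \<longlonglongrightarrow> measure M {\<omega> \<in> space M. num_points (X \<omega>) (ball 0 r) = 0}"
proof -
  obtain \<rho> where spp: "simple_point_process M X" and \<rho>: "joint_intensities M X lborel \<rho>"
    and det: "\<And>k x. k \<ge> 1 \<Longrightarrow> x \<in> space (Pi\<^sub>M {..<k} (\<lambda>_. lborel :: complex measure)) \<Longrightarrow>
      complex_of_real (\<rho> k x) =
        Determinant.det (Matrix.mat k k (\<lambda>(i, j). mittag_leffler_kernel \<alpha> (x i) (x j)))"
    using X unfolding determinantal_point_process_def by blast
  note K = trace_class_ml_basis[OF \<alpha> r]
  have fin: "finite (X \<omega> \<inter> ball 0 r)" if "\<omega> \<in> space M" for \<omega>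
  proof (rule finite_subset)
    show "X \<omega> \<inter> ball 0 r \<subseteq> X \<omega> \<inter> cball 0 r" by auto
    show "finite (X \<omega> \<inter> cball 0 r)" using spp that by (simp add: simple_point_process_def)
  qed
  have minor: "complex_of_real (\<rho> k x) = trace_class_kernel.minor (ml_basis \<alpha> r) k x"
    if "k \<ge> 1" "x \<in> {..<k} \<rightarrow>\<^sub>E ball 0 r" for k x
  proof -
    have "x \<in> space (Pi\<^sub>M {..<k} (\<lambda>_. lborel :: complex measure))"
      using that(2) by (simp add: space_PiM PiE_iff)
    then have "complex_of_real (\<rho> k x) =
        Determinant.det (Matrix.mat k k (\<lambda>(i, j). mittag_leffler_kernel \<alpha> (x i) (x j)))"
      by (rule det[OF that(1)])
    also have "Matrix.mat k k (\<lambda>(i, j). mittag_leffler_kernel \<alpha> (x i) (x j)) =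
        Matrix.mat k k (\<lambda>(i, j). trace_class_kernel.kernel (ml_basis \<alpha> r) (x i) (x j))"
    proof (rule cong_mat)
      fix i j assume "i < k" "j < k"
      then have "x i \<in> ball 0 r" "x j \<in> ball 0 r" using PiE_mem[OF that(2)] by blast+
      then show "(case (i, j) of (i, j) \<Rightarrow> mittag_leffler_kernel \<alpha> (x i) (x j)) =
          (case (i, j) of (i, j) \<Rightarrow> trace_class_kernel.kernel (ml_basis \<alpha> r) (x i) (x j))"
        by (simp only: prod.case ml_basis_kernel[OF \<alpha> r])
    qed simp_all
    also have "Determinant.det \<dots> = trace_class_kernel.minor (ml_basis \<alpha> r) k x"
      by (rule trace_class_kernel.minor_def[OF K, symmetric])
    finally show ?thesis .
  qed
  show ?thesis using void_probability_product[OF K spp \<rho> _ fin minor] by simp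
qed

theorem theorem4p1:
  fixes \<alpha> :: real and M :: "'w measure" and X :: "'w \<Rightarrow> complex set"
  assumes "\<alpha> > 0"
    and "determinantal_point_process M X lborel (mittag_leffler_kernel \<alpha>)"
  shows "((\<lambda>r::real. 1 / r powr (2 * \<alpha>) *
            ln (measure M {\<omega> \<in> space M.
              num_points (X \<omega>) ((\<lambda>z. complex_of_real r * z) ` ball 0 1) = 0}))
          \<longlongrightarrow> - (\<alpha> / 2) * (1 / 4)) at_top"
proof -
  let ?P = "\<lambda>r. measure M {\<omega> \<in> space M. num_points (X \<omega>) (ball 0 r) = 0}"
  define p where "p R = ?P (R powr (1 / \<alpha>))" for R
  have "((\<lambda>R. ln (p R) / R\<^sup>2) \<longlongrightarrow> - 1 / (4 * (2 / \<alpha>))) at_top"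
  proof (rule gamma_tail_product_asymptotics)
    fix R :: real assume R: "R > 0"
    then have "(R powr (1 / \<alpha>)) powr \<alpha> = R" using assms(1) by (simp add: powr_powr)
    then show "(\<lambda>J. \<Prod>j<J. gamma_tail (2 / \<alpha> * real (Suc j)) R) \<longlonglongrightarrow> p R"
      using hole_probability_product[OF assms(1) _ assms(2), of "R powr (1 / \<alpha>)"] R
      by (simp add: p_def del: of_nat_Suc)
  qed (use assms(1) in simp)
  moreover have "filterlim (\<lambda>r. r powr \<alpha>) at_top at_top" using assms(1) by real_asymp
  ultimately have "((\<lambda>r. ln (p (r powr \<alpha>)) / (r powr \<alpha>)\<^sup>2) \<longlongrightarrow> - 1 / (4 * (2 / \<alpha>))) at_top"
    by (rule filterlim_compose)
  also have "- 1 / (4 * (2 / \<alpha>)) = - (\<alpha> / 2) * (1 / 4)" by simp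
  finally show ?thesis
  proof (rule Lim_transform_eventually)
    show "\<forall>\<^sub>F r in at_top. ln (p (r powr \<alpha>)) / (r powr \<alpha>)\<^sup>2 = 1 / r powr (2 * \<alpha>) *
      ln (measure M {\<omega> \<in> space M. num_points (X \<omega>) ((\<lambda>z. complex_of_real r * z) ` ball 0 1) = 0})"
      using eventually_gt_at_top[of 0]
    proof eventually_elim
      case (elim r)
      have "(r powr \<alpha>) powr (1 / \<alpha>) = r" using assms(1) elim by (simp add: powr_powr)
      moreover have "(r powr \<alpha>)\<^sup>2 = r powr (2 * \<alpha>)" by (simp add: power2_eq_square flip: powr_add)
      ultimately show ?case by (simp add: p_def image_scale_ball[OF elim])
    qed
  qed
qed

end
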